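(* Let $m\ge 1$ be an integer. Then for every unitary operator $U$ on $\mathbb{C}^{5m}$ with $5m$ distinct eigenvalues, $\Lambda_{2m}(U)=\Omega_{2m}(U)$.
   Context: Let $T$ be an operator on $\mathbb{C}^N$ with eigenvalues $\lambda_1,\dots,\lambda_N$ (listed with multiplicity), and let $1\le k\le N$. $\Lambda_k(T)$ is the $k$th (higher-rank) numerical range: the set of $\lambda\in\mathbb{C}$ such that $PTP=\lambda P$ for some orthogonal projection $P$ of rank $k$. $\Omega_k(T)=\bigcap_{S}\operatorname{conv}\{\lambda_j: j\in S\}$, where $S$ runs over all subsets of $\{1,\dots,N\}$ with exactly $N-k+1$ elements. *)

theory Defs
  imports
    "HOL-Analysis.Analysis"
    "HOL-Combinatorics.List_Permutation"
    "Jordan_Normal_Form.Spectral_Radius"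
    "Jordan_Normal_Form.Schur_Decomposition"
    "Jordan_Normal_Form.DL_Rank"
begin

text \<open>Operators on \<open>\<complex>\<^sup>N\<close> are matrices in \<open>carrier_mat N N\<close> with respect to the standard
  orthonormal basis, so that \<open>mat_adjoint\<close> (conjugate transpose) is the Hilbert space adjoint.\<close>

definition unitary_mat :: "nat \<Rightarrow> complex mat \<Rightarrow> bool" where
  "unitary_mat N U \<longleftrightarrow>
     U \<in> carrier_mat N N \<and> mat_adjoint U * U = 1\<^sub>m N \<and> U * mat_adjoint U = 1\<^sub>m N"

definition orthogonal_projection :: "nat \<Rightarrow> complex mat \<Rightarrow> bool" where
  "orthogonal_projection N P \<longleftrightarrow>
     P \<in> carrier_mat N N \<and> P * P = P \<and> mat_adjoint P = P"

definition higher_rank_numerical_range :: "nat \<Rightarrow> complex mat \<Rightarrow> complex set" where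
  "higher_rank_numerical_range k T =
     {z. \<exists>P. orthogonal_projection (dim_row T) P \<and> vec_space.rank (dim_row T) P = k \<and>
             P * T * P = z \<cdot>\<^sub>m P}"

text \<open>The eigenvalues listed with (algebraic) multiplicity, in an unspecified order.
  They exist for every square matrix (\<open>char_poly_eigvals\<close>), and the set \<open>Omega\<close> below
  does not depend on the order chosen (\<open>Omega_eq\<close>).\<close>

definition eigvals :: "complex mat \<Rightarrow> complex list" where
  "eigvals T = (SOME ls. char_poly T = (\<Prod>a\<leftarrow>ls. [:- a, 1:]) \<and> length ls = dim_row T)"

definition Omega_list :: "nat \<Rightarrow> complex list \<Rightarrow> complex set" where
  "Omega_list k ls =
     (\<Inter>S \<in> {S. S \<subseteq> {..<length ls} \<and> card S = length ls - k + 1}.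
        convex hull ((\<lambda>j. ls ! j) ` S))"

definition Omega :: "nat \<Rightarrow> complex mat \<Rightarrow> complex set" where
  "Omega k T = Omega_list k (eigvals T)"

lemma char_poly_eigvals:
  assumes "T \<in> carrier_mat N N"
  shows "char_poly T = (\<Prod>a\<leftarrow>eigvals T. [:- a, 1:])" "length (eigvals T) = N"
proof -
  have "\<exists>ls. char_poly T = (\<Prod>a\<leftarrow>ls. [:- a, 1:]) \<and> length ls = dim_row T"
    using char_poly_factorized[OF assms] assms by auto
  from someI_ex[OF this] show "char_poly T = (\<Prod>a\<leftarrow>eigvals T. [:- a, 1:])"
    "length (eigvals T) = N"
    using assms unfolding eigvals_def by auto
qed

lemma Omega_list_mset_subset:
  assumes "mset ls = mset ls'"
  shows "Omega_list k ls \<subseteq> Omega_list k ls'"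
proof
  fix z assume z: "z \<in> Omega_list k ls"
  have len: "length ls = length ls'"
    using assms by (rule mset_eq_length)
  obtain f where f: "bij_betw f {..<length ls'} {..<length ls}"
      "\<And>i. i < length ls' \<Longrightarrow> ls' ! i = ls ! f i"
    using permutation_Ex_bij[of ls' ls] assms by metis
  show "z \<in> Omega_list k ls'"
    unfolding Omega_list_def
  proof (rule INT_I)
    fix S assume S: "S \<in> {S. S \<subseteq> {..<length ls'} \<and> card S = length ls' - k + 1}"
    have "f ` S \<subseteq> {..<length ls}" "card (f ` S) = length ls - k + 1"
      using S f(1) len by (auto simp: bij_betw_def card_image inj_on_subset)
    then have "z \<in> convex hull ((\<lambda>j. ls ! j) ` f ` S)"
      using z unfolding Omega_list_def by blast
    moreover have "(\<lambda>j. ls ! j) ` f ` S = (\<lambda>j. ls' ! j) ` S"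
      using S f(2) by (force simp: image_image intro!: image_cong)
    ultimately show "z \<in> convex hull ((\<lambda>j. ls' ! j) ` S)" by simp
  qed
qed

lemma order_prod_linear_factors:
  "Polynomial.order x (\<Prod>a\<leftarrow>ls. [:- a, 1:]) = count (mset ls) (x :: complex)"
proof (induction ls)
  case (Cons a ls)
  have "(\<Prod>a\<leftarrow>ls. [:- a, 1:]) \<noteq> 0"
    by (auto simp: prod_list_zero_iff)
  then have "Polynomial.order x ([:- a, 1:] * (\<Prod>a\<leftarrow>ls. [:- a, 1:])) =
      Polynomial.order x [:- a, 1:] + Polynomial.order x (\<Prod>a\<leftarrow>ls. [:- a, 1:])"
    by (intro order_mult) (simp del: mult_pCons_left)
  moreover have "Polynomial.order x [:- a, 1:] = (if x = a then 1 else 0)"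
    using order_power_n_n[of a 1] by (auto simp: order_0I)
  ultimately show ?case using Cons by (simp del: mult_pCons_left)
qed (simp add: order_0I)

lemma Omega_eq:
  assumes "T \<in> carrier_mat N N" "char_poly T = (\<Prod>a\<leftarrow>ls. [:- a, 1:])"
  shows "Omega k T = Omega_list k ls"
proof -
  have "mset (eigvals T) = mset ls"
    using order_prod_linear_factors char_poly_eigvals(1)[OF assms(1)] assms(2)
    by (metis multiset_eqI)
  then show ?thesis
    unfolding Omega_def using Omega_list_mset_subset by (metis subset_antisym)
qed

end

theory Submission
  imports Defs
begin

text \<open>
  The inclusion of the numerical range in \<open>Omega\<close> is a dimension count: the range of a rank \<open>k\<close>
  projection meets every span of \<open>N - k + 1\<close> eigenvectors.

  Conversely let \<open>\<mu>\<close> lie in \<open>Omega\<close> and list the points \<open>z = \<lambda> - \<mu>\<close> by increasing argument,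
  cyclically. If the gap between the \<open>c\<close>-th and the \<open>(c + 2m)\<close>-th argument exceeded \<open>\<pi>\<close>, then
  \<open>3m + 1\<close> of the points would lie in an open half-plane, contradicting \<open>\<mu> \<in> Omega\<close>. So the
  \<open>m\<close> groups of five points with positions congruent modulo \<open>m\<close> all inherit the condition for
  \<open>N = 5\<close>, \<open>k = 2\<close>, and it suffices to find, for each group, two orthonormal real vectors
  \<open>u, v\<close> with \<open>\<Sum> u\<^sup>2 z = \<Sum> u v z = \<Sum> v\<^sup>2 z = 0\<close>. For weights \<open>p > 0\<close>, the vectors \<open>\<surd>p Re z\<close> and
  \<open>\<surd>p Im z\<close> satisfy these equations if \<open>p\<close> annihilates all cubic forms in \<open>(Re z, Im z)\<close>; this
  determines \<open>p\<close> up to scaling as a signed vector of homogeneous Vandermonde minors, and the cyclic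
  order of the points makes it positive.
\<close>

section \<open>Five points around the origin\<close>

text \<open>The determinant of \<open>a\<close> and \<open>b\<close> as plane vectors, that is,
  \<open>Im (cnj a * b)\<close>. It is positive exactly when both are nonzero and \<open>b\<close>
  lies counterclockwise from \<open>a\<close> by an angle strictly between 0 and
  \<open>pi\<close>.\<close>

definition wedge :: "complex \<Rightarrow> complex \<Rightarrow> real" where
  "wedge a b = Re a * Im b - Im a * Re b"

text \<open>Cramer's rule in the plane: an explicit linear dependence among any three vectors, with
  wedges as coefficients.\<close>

lemma wedge_three_term:
  "wedge b c *\<^sub>R a + wedge c a *\<^sub>R b + wedge a b *\<^sub>R c = 0"
  by (simp add: complex_eq_iff wedge_def algebra_simps)

text \<open>The factored form of the homogeneous Vandermonde determinant, whose rows list the four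
  cubic monomials in \<open>Re\<close> and \<open>Im\<close>, by rising power of \<open>Im\<close>,
  at the four points.\<close>

definition wedge_vandermonde :: "complex \<Rightarrow> complex \<Rightarrow> complex \<Rightarrow> complex \<Rightarrow> real" where
  "wedge_vandermonde a b c d =
     wedge a b * wedge a c * wedge a d * wedge b c * wedge b d * wedge c d"

text \<open>This is the expansion of a 5 by 5 determinant along a column holding the values of
  \<open>F\<close>. The other columns hold the four cubic monomials at the five points;
  \<open>F\<close> is one of them, so two columns agree.\<close>

lemma cubic_vandermonde_relation:
  fixes a b c d e :: complex and i j :: nat
  assumes "i + j = 3"
  defines "F \<equiv> \<lambda>z. Re z ^ i * Im z ^ j"
  shows "F a * wedge_vandermonde b c d e - F b * wedge_vandermonde a c d e
    + F c * wedge_vandermonde a b d e - F d * wedge_vandermonde a b c e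
    + F e * wedge_vandermonde a b c d = 0"
proof -
  (* HOL-Algebra shadows the Groebner basis method, hence the qualified name. *)
  consider "i = 0" "j = 3" | "i = 1" "j = 2" | "i = 2" "j = 1" | "i = 3" "j = 0"
    using assms(1) by linarith
  then show ?thesis
  proof cases
    case 1 show ?thesis unfolding F_def wedge_vandermonde_def wedge_def 1 power_0 by Groebner_Basis.algebra
  next
    case 2 show ?thesis unfolding F_def wedge_vandermonde_def wedge_def 2 power_one_right by Groebner_Basis.algebra
  next
    case 3 show ?thesis unfolding F_def wedge_vandermonde_def wedge_def 3 power_one_right by Groebner_Basis.algebra
  next
    case 4 show ?thesis unfolding F_def wedge_vandermonde_def wedge_def 4 power_0 by Groebner_Basis.algebra
  qed
qed

text \<open>The conditions \<open>B\<close> are bilinear, so they pass to all pairs in the span of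
  \<open>x\<close> and \<open>y\<close>, and Gram-Schmidt picks an orthonormal pair there. The
  nonzero minor certifies linear independence.\<close>

lemma orthonormal_pair_exists:
  fixes x y :: "'a \<Rightarrow> real" and z :: "'a \<Rightarrow> complex"
  assumes A: "finite A" and ij: "i \<in> A" "j \<in> A" "x i * y j \<noteq> x j * y i"
    and B: "(\<Sum>t\<in>A. (x t * x t) *\<^sub>R z t) = 0" "(\<Sum>t\<in>A. (x t * y t) *\<^sub>R z t) = 0"
      "(\<Sum>t\<in>A. (y t * y t) *\<^sub>R z t) = 0"
  obtains u v where
    "(\<Sum>t\<in>A. u t * u t) = 1" "(\<Sum>t\<in>A. u t * v t) = 0" "(\<Sum>t\<in>A. v t * v t) = 1"
    "(\<Sum>t\<in>A. (u t * u t) *\<^sub>R z t) = 0" "(\<Sum>t\<in>A. (u t * v t) *\<^sub>R z t) = 0"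
    "(\<Sum>t\<in>A. (v t * v t) *\<^sub>R z t) = 0"
proof -
  have pos: "(\<Sum>t\<in>A. f t * f t) > 0" if "t \<in> A" "f t \<noteq> 0" for f :: "'a \<Rightarrow> real" and t
    by (rule sum_pos2[OF A that(1)]) (use that in \<open>auto simp: zero_less_mult_iff linorder_neq_iff\<close>)
  define n where "n = (\<Sum>t\<in>A. x t * x t)"
  define c where "c = (\<Sum>t\<in>A. x t * y t) / n"
  define w where "w t = y t - c * x t" for t
  define k where "k = (\<Sum>t\<in>A. w t * w t)"
  have n: "n > 0"
    unfolding n_def using ij pos by (cases "x i = 0") auto
  \<comment> \<open>Subtracting a multiple of \<open>x\<close> from \<open>y\<close> does not change
    the minor, so \<open>w\<close> cannot vanish at both indices.\<close>
  have "x i * w j - x j * w i \<noteq> 0"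
    using ij(3) by (simp add: w_def algebra_simps)
  then have k: "k > 0"
    unfolding k_def using ij pos by (cases "w i = 0") auto
  have xw: "(\<Sum>t\<in>A. x t * w t) = 0"
  proof -
    have "(\<Sum>t\<in>A. x t * w t) = (\<Sum>t\<in>A. x t * y t) - c * n"
      unfolding n_def sum_distrib_left sum_subtractf[symmetric]
      by (rule sum.cong) (auto simp: w_def algebra_simps)
    then show ?thesis using n by (simp add: c_def)
  qed
  have Bxw: "(\<Sum>t\<in>A. (x t * w t) *\<^sub>R z t) = 0"
  proof -
    have "(\<Sum>t\<in>A. (x t * w t) *\<^sub>R z t)
        = (\<Sum>t\<in>A. (x t * y t) *\<^sub>R z t) - c *\<^sub>R (\<Sum>t\<in>A. (x t * x t) *\<^sub>R z t)"
      by (simp add: w_def algebra_simps sum_subtractf scaleR_sum_right)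
    then show ?thesis using B by simp
  qed
  have Bww: "(\<Sum>t\<in>A. (w t * w t) *\<^sub>R z t) = 0"
  proof -
    have "(\<Sum>t\<in>A. (w t * w t) *\<^sub>R z t) = (\<Sum>t\<in>A. (y t * y t) *\<^sub>R z t)
        - (2 * c) *\<^sub>R (\<Sum>t\<in>A. (x t * y t) *\<^sub>R z t) + (c * c) *\<^sub>R (\<Sum>t\<in>A. (x t * x t) *\<^sub>R z t)"
      unfolding scaleR_sum_right sum_subtractf[symmetric] sum.distrib[symmetric]
      by (rule sum.cong) (auto simp: w_def complex_eq_iff algebra_simps)
    then show ?thesis using B by simp
  qed
  have G: "(\<Sum>t\<in>A. f t / sqrt p * (g t / sqrt q)) = (\<Sum>t\<in>A. f t * g t) / (sqrt p * sqrt q)"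
    for f g :: "'a \<Rightarrow> real" and p q
    by (simp add: sum_divide_distrib)
  have H: "(\<Sum>t\<in>A. (f t / sqrt p * (g t / sqrt q)) *\<^sub>R z t)
    = (1 / (sqrt p * sqrt q)) *\<^sub>R (\<Sum>t\<in>A. (f t * g t) *\<^sub>R z t)"
    for f g :: "'a \<Rightarrow> real" and p q
    by (simp add: scaleR_sum_right)
  show thesis
  proof (rule that[of "\<lambda>t. x t / sqrt n" "\<lambda>t. w t / sqrt k"])
    show "(\<Sum>t\<in>A. x t / sqrt n * (x t / sqrt n)) = 1"
      unfolding G n_def[symmetric] using n by simp
    show "(\<Sum>t\<in>A. w t / sqrt k * (w t / sqrt k)) = 1"
      unfolding G k_def[symmetric] using k by simp
    show "(\<Sum>t\<in>A. x t / sqrt n * (w t / sqrt k)) = 0"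
      unfolding G xw by simp
  qed (simp_all only: H B Bxw Bww scaleR_zero_right)
qed

text \<open>With strict positivity, all coefficients of the cubic relation have the same sign. Up to
  a global sign they are weights whose square roots can be absorbed into \<open>x\<close> and
  \<open>y\<close>.\<close>

lemma five_points_generic:
  fixes z :: "nat \<Rightarrow> complex"
  assumes "\<And>j. j < 5 \<Longrightarrow> wedge (z j) (z ((j + 1) mod 5)) > 0"
    and "\<And>j. j < 5 \<Longrightarrow> wedge (z j) (z ((j + 2) mod 5)) > 0"
  obtains x y :: "nat \<Rightarrow> real" where "x 0 * y 1 \<noteq> x 1 * y 0"
    "(\<Sum>t<5. (x t * x t) *\<^sub>R z t) = 0" "(\<Sum>t<5. (x t * y t) *\<^sub>R z t) = 0"
    "(\<Sum>t<5. (y t * y t) *\<^sub>R z t) = 0"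
proof -
  let ?V = "\<lambda>i j k l. wedge_vandermonde (z i) (z j) (z k) (z l)"
  \<comment> \<open>The coefficients of the cubic relation times -1. The last branch also covers
    indices beyond 4, so positivity needs no bound on \<open>t\<close>.\<close>
  define p where "p t = (if t = 0 then - ?V 1 2 3 4 else if t = 1 then ?V 0 2 3 4
    else if t = 2 then - ?V 0 1 3 4 else if t = 3 then ?V 0 1 2 4 else - ?V 0 1 2 3)" for t :: nat
  have anti: "wedge a b = - wedge b a" for a b
    by (simp add: wedge_def)
  \<comment> \<open>The negative signs belong to the pairs whose cyclic step runs past 4 back to the
    start, here written in increasing order.\<close>
  have s: "wedge (z 0) (z 1) > 0" "wedge (z 1) (z 2) > 0" "wedge (z 2) (z 3) > 0"
    "wedge (z 3) (z 4) > 0" "wedge (z 0) (z 2) > 0" "wedge (z 1) (z 3) > 0"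
    "wedge (z 2) (z 4) > 0" "wedge (z 0) (z 3) < 0" "wedge (z 1) (z 4) < 0" "wedge (z 0) (z 4) < 0"
    using assms(1)[of 0] assms(1)[of 1] assms(1)[of 2] assms(1)[of 3] assms(1)[of 4]
      assms(2)[of 0] assms(2)[of 1] assms(2)[of 2] assms(2)[of 3] assms(2)[of 4]
      anti[of "z 0" "z 3"] anti[of "z 1" "z 4"] anti[of "z 0" "z 4"]
    by (simp_all add: numeral_2_eq_2[symmetric] flip: One_nat_def)
  have p: "p t > 0" for t
    using s by (auto simp: p_def wedge_vandermonde_def zero_less_mult_iff mult_less_0_iff)
  have five: "sum f {..<5} = f 0 + f 1 + f 2 + f 3 + f 4" for f :: "nat \<Rightarrow> complex"
    by (simp add: eval_nat_numeral)
  have cubic: "p 0 * F (z 0) + p 1 * F (z 1) + p 2 * F (z 2) + p 3 * F (z 3) + p 4 * F (z 4) = 0"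
    if "i + j = 3" "\<And>z. F z = Re z ^ i * Im z ^ j" for F i j
    using cubic_vandermonde_relation[OF that(1), of "z 0" "z 1" "z 2" "z 3" "z 4"]
    by (simp add: p_def that(2) algebra_simps)
  define x where "x t = sqrt (p t) * Re (z t)" for t
  define y where "y t = sqrt (p t) * Im (z t)" for t
  have sq: "x t * x t = p t * (Re (z t) * Re (z t))" "x t * y t = p t * (Re (z t) * Im (z t))"
    "y t * y t = p t * (Im (z t) * Im (z t))" for t
    using p[of t] by (simp_all add: x_def y_def algebra_simps flip: power2_eq_square)
  show thesis
  proof (rule that[of x y])
    have "x 0 * y 1 - x 1 * y 0 = sqrt (p 0) * sqrt (p 1) * wedge (z 0) (z 1)"
      by (simp add: x_def y_def wedge_def algebra_simps)
    also have "\<dots> > 0"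
      using p s by simp
    finally show "x 0 * y 1 \<noteq> x 1 * y 0" by simp
    \<comment> \<open>The real and the imaginary part are each a sum of \<open>p\<close> against one
      cubic monomial; likewise for the next two equations.\<close>
    show "(\<Sum>t<5. (x t * x t) *\<^sub>R z t) = 0"
      using cubic[of 3 0 "\<lambda>z. Re z * Re z * Re z"] cubic[of 2 1 "\<lambda>z. Re z * Re z * Im z"]
      by (simp add: five complex_eq_iff sq algebra_simps power3_eq_cube power2_eq_square)
    show "(\<Sum>t<5. (x t * y t) *\<^sub>R z t) = 0"
      using cubic[of 2 1 "\<lambda>z. Re z * Re z * Im z"] cubic[of 1 2 "\<lambda>z. Re z * Im z * Im z"]
      by (simp add: five complex_eq_iff sq algebra_simps power3_eq_cube power2_eq_square)
    show "(\<Sum>t<5. (y t * y t) *\<^sub>R z t) = 0"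
      using cubic[of 1 2 "\<lambda>z. Re z * Im z * Im z"] cubic[of 0 3 "\<lambda>z. Im z * Im z * Im z"]
      by (simp add: five complex_eq_iff sq algebra_simps power3_eq_cube power2_eq_square)
  qed
qed

text \<open>Here \<open>z a\<close> and \<open>z c\<close> point in opposite directions and the other three points surround the
  origin, which yields two vectors with disjoint supports.\<close>

lemma five_points_degenerate:
  fixes z :: "nat \<Rightarrow> complex"
  assumes A: "distinct [a, b, c, d, e]" "A = {a, b, c, d, e}"
    and w: "wedge (z a) (z b) > 0" "wedge (z b) (z c) > 0" "wedge (z d) (z e) > 0"
      "wedge (z a) (z c) = 0" "wedge (z b) (z d) \<ge> 0" "wedge (z e) (z b) \<ge> 0"
  obtains x y :: "nat \<Rightarrow> real" where "x a * y b \<noteq> x b * y a"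
    "(\<Sum>t\<in>A. (x t * x t) *\<^sub>R z t) = 0" "(\<Sum>t\<in>A. (x t * y t) *\<^sub>R z t) = 0"
    "(\<Sum>t\<in>A. (y t * y t) *\<^sub>R z t) = 0"
proof -
  \<comment> \<open>The squared entries are the coefficients in \<open>wedge_three_term\<close>: for
    \<open>x\<close> at the points \<open>a\<close>, \<open>b\<close>, \<open>c\<close>, where the
    coefficient of \<open>z b\<close> vanishes, and for \<open>y\<close> at \<open>b\<close>,
    \<open>d\<close>, \<open>e\<close>.\<close>
  define x where "x t = (if t = a then sqrt (wedge (z b) (z c))
    else if t = c then sqrt (wedge (z a) (z b)) else 0)" for t
  define y where "y t = (if t = b then sqrt (wedge (z d) (z e))
    else if t = d then sqrt (wedge (z e) (z b))
    else if t = e then sqrt (wedge (z b) (z d)) else 0)" for t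
  have "wedge (z c) (z a) = 0"
    using w(4) by (simp add: wedge_def mult.commute)
  then show thesis
    using A w wedge_three_term[of "z b" "z c" "z a"] wedge_three_term[of "z e" "z b" "z d"]
    by (intro that[of x y]) (auto simp: x_def y_def algebra_simps)
qed

text \<open>If some wedge of second neighbours vanishes, then so does every Vandermonde weight
  containing both points. That case is rotated to start at such a point and handed to
  \<open>five_points_degenerate\<close>.\<close>

lemma five_points:
  fixes z :: "nat \<Rightarrow> complex"
  assumes pos: "\<And>j. j < 5 \<Longrightarrow> wedge (z j) (z ((j + 1) mod 5)) > 0"
    and nonneg: "\<And>j. j < 5 \<Longrightarrow> wedge (z j) (z ((j + 2) mod 5)) \<ge> 0"
  obtains u v :: "nat \<Rightarrow> real" where
    "(\<Sum>t<5. u t * u t) = 1" "(\<Sum>t<5. u t * v t) = 0" "(\<Sum>t<5. v t * v t) = 1"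
    "(\<Sum>t<5. (u t * u t) *\<^sub>R z t) = 0" "(\<Sum>t<5. (u t * v t) *\<^sub>R z t) = 0"
    "(\<Sum>t<5. (v t * v t) *\<^sub>R z t) = 0"
proof -
  have "\<exists>x y :: nat \<Rightarrow> real. \<exists>i<5. \<exists>j<5. x i * y j \<noteq> x j * y i \<and>
    (\<Sum>t<5. (x t * x t) *\<^sub>R z t) = 0 \<and> (\<Sum>t<5. (x t * y t) *\<^sub>R z t) = 0 \<and>
    (\<Sum>t<5. (y t * y t) *\<^sub>R z t) = 0"
  proof (cases "\<exists>a<5. wedge (z a) (z ((a + 2) mod 5)) = 0")
    case True
    then obtain a where a: "a < 5" "wedge (z a) (z ((a + 2) mod 5)) = 0" by blast
    have eq: "((a + i) mod 5 + j) mod 5 = (a + (i + j)) mod 5" for i j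
      by presburger
    have L: "{..<5} = {0, 1, 2, 3, 4 :: nat}" by auto
    have "a = 0 \<or> a = 1 \<or> a = 2 \<or> a = 3 \<or> a = 4" using a(1) by linarith
    then have A: "distinct [a, (a + 1) mod 5, (a + 2) mod 5, (a + 3) mod 5, (a + 4) mod 5] \<and>
      {..<5} = {a, (a + 1) mod 5, (a + 2) mod 5, (a + 3) mod 5, (a + 4) mod 5}"
      unfolding L by (elim disjE) (hypsubst, simp add: numeral_2_eq_2, blast?)+
    have *: "wedge (z ((a + i) mod 5)) (z ((a + k) mod 5)) > 0" if "k = i + 1" for i k
      using pos[of "(a + i) mod 5"] unfolding eq that by simp
    have **: "wedge (z ((a + i) mod 5)) (z ((a + k) mod 5)) \<ge> 0" if "k = i + 2" for i k
      using nonneg[of "(a + i) mod 5"] unfolding eq that by simp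
    \<comment> \<open>The last point and the second one are two cyclic steps apart; writing 6 for 1
      makes this visible to the second-neighbour bound.\<close>
    have six: "(a + 6) mod 5 = (a + 1) mod 5" by presburger
    have z0: "(a + 0) mod 5 = a" using a(1) by simp
    obtain x y :: "nat \<Rightarrow> real" where "x a * y ((a + 1) mod 5) \<noteq> x ((a + 1) mod 5) * y a"
      "(\<Sum>t<5. (x t * x t) *\<^sub>R z t) = 0" "(\<Sum>t<5. (x t * y t) *\<^sub>R z t) = 0"
      "(\<Sum>t<5. (y t * y t) *\<^sub>R z t) = 0"
    proof (rule five_points_degenerate[OF conjunct1[OF A] conjunct2[OF A], of z])
      show "wedge (z a) (z ((a + 1) mod 5)) > 0"
        using *[of 1 0] z0 by simp
      show "wedge (z ((a + 1) mod 5)) (z ((a + 2) mod 5)) > 0"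
        by (rule *) simp
      show "wedge (z ((a + 3) mod 5)) (z ((a + 4) mod 5)) > 0"
        by (rule *) simp
      show "wedge (z ((a + 1) mod 5)) (z ((a + 3) mod 5)) \<ge> 0"
        by (rule **) simp
      show "wedge (z ((a + 4) mod 5)) (z ((a + 1) mod 5)) \<ge> 0"
        unfolding six[symmetric] by (rule **) simp
    qed (use a(2) in auto)
    moreover have "(a + 1) mod 5 < 5" by simp
    ultimately show ?thesis using a(1) by blast
  next
    case False
    then have "\<And>j. j < 5 \<Longrightarrow> wedge (z j) (z ((j + 2) mod 5)) > 0"
      using nonneg by (metis order_le_less)
    from five_points_generic[OF pos this] obtain x y :: "nat \<Rightarrow> real" where
      "x 0 * y 1 \<noteq> x 1 * y 0" "(\<Sum>t<5. (x t * x t) *\<^sub>R z t) = 0"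
      "(\<Sum>t<5. (x t * y t) *\<^sub>R z t) = 0" "(\<Sum>t<5. (y t * y t) *\<^sub>R z t) = 0" .
    moreover have "(0 :: nat) < 5" "(1 :: nat) < 5" by simp_all
    ultimately show ?thesis by blast
  qed
  then obtain x y :: "nat \<Rightarrow> real" and i j where ij: "i < 5" "j < 5" "x i * y j \<noteq> x j * y i" and
    B: "(\<Sum>t<5. (x t * x t) *\<^sub>R z t) = 0" "(\<Sum>t<5. (x t * y t) *\<^sub>R z t) = 0"
      "(\<Sum>t<5. (y t * y t) *\<^sub>R z t) = 0" by blast
  show thesis
    by (rule orthonormal_pair_exists[OF finite_lessThan _ _ ij(3) B]) (use ij that in auto)
qed

section \<open>Cyclic order by argument\<close>

text \<open>Sorting by \<open>Arg\<close> and continuing periodically lifts the arguments to a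
  strictly increasing sequence of angles, so later gap estimates need no case split at the branch
  cut.\<close>

lemma cyclic_angle_enumeration:
  fixes z :: "nat \<Rightarrow> complex"
  assumes N: "N > 0" and inj: "inj_on (\<lambda>i. Arg (z i)) {..<N}"
  obtains \<theta> :: "nat \<Rightarrow> real" and p :: "nat \<Rightarrow> nat" where
    "bij_betw p {..<N} {..<N}" "\<And>c. p (c + N) = p c" "strict_mono \<theta>"
    "\<And>c. \<theta> (c + N) = \<theta> c + 2 * pi" "\<And>c. z (p c) = rcis (cmod (z (p c))) (\<theta> c)"
proof -
  let ?A = "(\<lambda>i. Arg (z i)) ` {..<N}"
  define ts where "ts = sorted_list_of_set ?A"
  have ts: "set ts = ?A" "length ts = N" "sorted_wrt (<) ts"
    by (simp_all add: ts_def card_image[OF inj])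
  define q where "q = the_inv_into {..<N} (\<lambda>i. Arg (z i))"
  define p where "p c = q (ts ! (c mod N))" for c
  define \<theta> where "\<theta> c = ts ! (c mod N) + 2 * pi * real (c div N)" for c
  have "bij_betw (nth ts) {..<N} ?A"
    using bij_betw_nth[of ts "{..<N}" ?A] ts strict_sorted_iff by auto
  moreover have "bij_betw q ?A {..<N}"
    unfolding q_def using inj by (simp add: bij_betw_the_inv_into inj_on_imp_bij_betw)
  ultimately have "bij_betw (q \<circ> nth ts) {..<N} {..<N}"
    by (rule bij_betw_trans)
  then have bij: "bij_betw p {..<N} {..<N}"
    by (rule bij_betw_cong[THEN iffD1, rotated]) (simp add: p_def)
  have Arg_p: "Arg (z (p c)) = ts ! (c mod N)" for c
  proof -
    have "ts ! (c mod N) \<in> ?A"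
      using ts N by (metis mod_less_divisor nth_mem)
    then show ?thesis
      unfolding p_def q_def using f_the_inv_into_f[OF inj] by simp
  qed
  have step: "\<theta> c < \<theta> (Suc c)" for c
  proof (cases "Suc (c mod N) = N")
    case True
    then have "Suc c mod N = 0" "Suc c div N = Suc (c div N)"
      by (simp_all add: mod_Suc div_Suc)
    \<comment> \<open>At the wrap-around the angle still increases, because principal arguments lie
      in a half-open interval of length \<open>2 * pi\<close>.\<close>
    moreover have "ts ! (c mod N) \<le> pi" "ts ! 0 > - pi"
      using Arg_p[of c] Arg_p[of 0] Arg_le_pi[of "z (p c)"] mpi_less_Arg[of "z (p 0)"] by simp_all
    ultimately show ?thesis
      by (simp add: \<theta>_def algebra_simps)
  next
    case False
    then have "Suc c mod N = Suc (c mod N)" "Suc c div N = c div N" "Suc (c mod N) < N"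
      using N mod_less_divisor[of N c] by (auto simp: mod_Suc div_Suc simp del: mod_less_divisor)
    then show ?thesis
      using sorted_wrt_nth_less[OF ts(3), of "c mod N" "Suc (c mod N)"] ts(2) by (simp add: \<theta>_def)
  qed
  show thesis
  proof (rule that[of p \<theta>])
    show "\<theta> (c + N) = \<theta> c + 2 * pi" for c
      using N by (simp add: \<theta>_def algebra_simps)
    show "z (p c) = rcis (cmod (z (p c))) (\<theta> c)" for c
    proof -
      have "cis (\<theta> c) = cis (Arg (z (p c)))"
        unfolding Arg_p \<theta>_def cis_mult[symmetric]
        by (simp add: cis_multiple_2pi)
      then show ?thesis
        by (metis rcis_cmod_Arg rcis_def)
    qed
  qed (use bij step in \<open>auto simp: p_def strict_mono_Suc_iff\<close>)
qed

lemma wedge_rcis: "wedge (rcis r a) (rcis s b) = r * s * sin (b - a)"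
  by (simp add: wedge_def rcis_def sin_diff algebra_simps)

text \<open>An open half-plane with the origin on its boundary line is convex and omits 0, so it
  cannot contain \<open>X\<close>.\<close>

lemma convex_hull_not_open_half_plane:
  fixes w :: complex
  assumes "0 \<in> convex hull X"
  shows "\<exists>x\<in>X. Re (w * x) \<le> 0"
proof (rule ccontr)
  assume "\<not> ?thesis"
  then have "X \<subseteq> {x. Re (w * x) > 0}" by auto
  moreover have "convex {x. Re (w * x) > 0}"
    using convex_halfspace_gt[of 0 "cnj w"] by (simp add: inner_complex_def)
  ultimately have "convex hull X \<subseteq> {x. Re (w * x) > 0}"
    by (rule hull_minimal)
  with assms show False by auto
qed

text \<open>The positions from \<open>c + k\<close> to \<open>c + N\<close> are \<open>Suc n\<close>
  distinct points, the last being the point of position \<open>c\<close> one turn later. Their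
  angles span \<open>2 * pi\<close> minus the gap, so a gap above \<open>pi\<close> would put them
  in an open half-plane.\<close>

lemma angle_gap_le_pi:
  fixes z :: "nat \<Rightarrow> complex"
  assumes mn: "Suc n \<le> N" and k: "k + n = N"
    and p: "bij_betw p {..<N} {..<N}" "\<And>c. p (c + N) = p c"
    and \<theta>: "strict_mono \<theta>" "\<And>c. \<theta> (c + N) = \<theta> c + 2 * pi"
    and z: "\<And>c. z (p c) = rcis (cmod (z (p c))) (\<theta> c)" "\<And>i. i < N \<Longrightarrow> z i \<noteq> 0"
    and hull: "\<And>S. S \<subseteq> {..<N} \<Longrightarrow> card S = Suc n \<Longrightarrow> 0 \<in> convex hull (z ` S)"
  shows "\<theta> (c + k) - \<theta> c \<le> pi"
proof (rule ccontr)
  assume gap: "\<not> \<theta> (c + k) - \<theta> c \<le> pi"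
  have N: "N > 0" using mn by simp
  have pmod: "p d = p (d mod N)" for d
  proof -
    have "p (e + N * j) = p e" for e j
      by (induction j) (simp_all add: p(2) add.assoc[symmetric] add.commute[of N])
    from this[of "d mod N" "d div N"] show ?thesis by simp
  qed
  have prange: "p d < N" for d
    unfolding pmod[of d] using p(1) N by (auto simp: bij_betw_def)
  let ?S = "p ` {c + k..c + N}"
  have "inj_on p {c + k..c + N}"
  proof (rule inj_onI)
    fix d e assume de: "d \<in> {c + k..c + N}" "e \<in> {c + k..c + N}" "p d = p e"
    have eq: "d mod N = e mod N"
    proof (rule inj_onD[OF bij_betw_imp_inj_on[OF p(1)]])
      show "p (d mod N) = p (e mod N)" by (simp only: pmod[symmetric] de(3))
    qed (use N in simp_all)
    have le: "a = b" if "a mod N = b mod N" "a \<le> b" "b < a + N" for a b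
    proof -
      have "N dvd b - a" using that mod_eq_dvd_iff_nat[of a b N] by simp
      moreover have "b - a < N" using that by linarith
      ultimately show ?thesis using that(2) dvd_imp_le by fastforce
    qed
    have "e < d + N" "d < e + N" using de mn k by auto
    then show "d = e"
      using le[OF eq] le[OF eq[symmetric]] by (cases "d \<le> e") auto
  qed
  then have "card ?S = Suc n"
    using k by (simp add: card_image)
  then have hS: "0 \<in> convex hull (z ` ?S)"
    using prange by (intro hull) auto
  \<comment> \<open>The bisecting direction of the sector; all angles in it differ from
    \<open>m\<close> by less than \<open>pi / 2\<close>.\<close>
  define m where "m = (\<theta> (c + k) + \<theta> (c + N)) / 2"
  have "\<exists>x\<in>z ` ?S. Re (cis (- m) * x) \<le> 0"
    using convex_hull_not_open_half_plane[OF hS] .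
  then obtain d where d: "d \<in> {c + k..c + N}" "Re (cis (- m) * z (p d)) \<le> 0"
    by auto
  have "\<theta> (c + k) \<le> \<theta> d" "\<theta> d \<le> \<theta> (c + N)"
    using \<theta>(1) d(1) by (auto simp: strict_mono_less_eq)
  then have "\<bar>\<theta> d - m\<bar> < pi / 2"
    using gap \<theta>(2)[of c] unfolding m_def by (simp add: field_simps abs_less_iff)
  then have "cos (\<theta> d - m) > 0"
    by (intro cos_gt_zero_pi) linarith+
  moreover have "Re (cis (- m) * z (p d)) = cmod (z (p d)) * cos (\<theta> d - m)"
    by (subst z(1)) (simp add: rcis_def cos_diff algebra_simps)
  ultimately show False
    using d(2) z(2)[OF prange[of d]] by (auto simp: mult_le_0_iff)
qed

text \<open>Group \<open>g\<close> takes the positions \<open>g + j * m\<close>, so two steps inside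
  a group advance by \<open>2 * m\<close> positions and turn by at most \<open>pi\<close>. A single
  step turns by strictly less, which makes its wedge strictly positive.\<close>

lemma five_groups:
  fixes z :: "nat \<Rightarrow> complex" and m :: nat
  assumes m: "m \<ge> 1" and z: "\<And>i. i < 5 * m \<Longrightarrow> z i \<noteq> 0" "inj_on (\<lambda>i. Arg (z i)) {..<5 * m}"
    and hull: "\<And>S. S \<subseteq> {..<5 * m} \<Longrightarrow> card S = 3 * m + 1 \<Longrightarrow> 0 \<in> convex hull (z ` S)"
  obtains p where "bij_betw p {..<5 * m} {..<5 * m}"
    "\<And>g j. g < m \<Longrightarrow> j < 5 \<Longrightarrow> wedge (z (p (g + j * m))) (z (p (g + (j + 1) mod 5 * m))) > 0"
    "\<And>g j. g < m \<Longrightarrow> j < 5 \<Longrightarrow> wedge (z (p (g + j * m))) (z (p (g + (j + 2) mod 5 * m))) \<ge> 0"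
proof -
  have "5 * m > 0" using m by simp
  from cyclic_angle_enumeration[OF this z(2)] obtain \<theta> p where
    p: "bij_betw p {..<5 * m} {..<5 * m}" "\<And>c. p (c + 5 * m) = p c" and
    \<theta>: "strict_mono \<theta>" "\<And>c. \<theta> (c + 5 * m) = \<theta> c + 2 * pi" and
    zp: "\<And>c. z (p c) = rcis (cmod (z (p c))) (\<theta> c)" by metis
  have gap: "\<theta> (c + 2 * m) - \<theta> c \<le> pi" for c
  proof (rule angle_gap_le_pi[where n = "3 * m" and N = "5 * m" and k = "2 * m" and p = p
        and z = z and \<theta> = \<theta>])
    show "p (d + 5 * m) = p d" "\<theta> (d + 5 * m) = \<theta> d + 2 * pi"
      "z (p d) = rcis (cmod (z (p d))) (\<theta> d)" for d
      by (fact p(2) \<theta>(2) zp)+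
  qed (use m p(1) \<theta>(1) z(1) hull in simp_all)
  \<comment> \<open>Reducing the index modulo 5 shifts the position by \<open>5 * m\<close>, a full
    period of \<open>p\<close>.\<close>
  have wrap: "p (g + (j + i) mod 5 * m) = p (g + j * m + i * m)" if "j < 5" "i < 5" for g i j
  proof (cases "j + i < 5")
    case True
    then show ?thesis by (simp add: algebra_simps)
  next
    case False
    then have "j + i = (j + i) mod 5 + 5" using that by presburger
    from arg_cong[OF this, of "\<lambda>x. x * m"]
    have "g + j * m + i * m = g + (j + i) mod 5 * m + 5 * m"
      by (simp add: distrib_right)
    then show ?thesis using p(2) by metis
  qed
  have pos: "cmod (z (p c)) > 0" if "c < 5 * m" for c
    using z(1) p(1) that by (auto simp: bij_betw_def)
  have w: "wedge (z (p c)) (z (p d)) = cmod (z (p c)) * cmod (z (p d)) * sin (\<theta> d - \<theta> c)" for c d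
    by (subst (1 2) zp) (rule wedge_rcis)
  have ppos: "cmod (z (p (g + j * m))) > 0" if "g < m" "j < 5" for g j
  proof (rule pos)
    have "j * m \<le> 4 * m" using that by (intro mult_right_mono) auto
    then show "g + j * m < 5 * m" using that by linarith
  qed
  show thesis
  proof (rule that[OF p(1)])
    fix g j :: nat assume gj: "g < m" "j < 5"
    let ?c = "g + j * m"
    have lt: "\<theta> ?c < \<theta> (?c + m)" "\<theta> (?c + m) < \<theta> (?c + 2 * m)"
      using \<theta>(1) m by (auto simp: strict_mono_less)
    show "wedge (z (p ?c)) (z (p (g + (j + 1) mod 5 * m))) > 0"
    proof -
      have "sin (\<theta> (?c + m) - \<theta> ?c) > 0"
        using lt gap[of ?c] by (intro sin_gt_zero) auto
      then show ?thesis
        using ppos[OF gj] ppos[of g "(j + 1) mod 5"] gj wrap[of j 1 g]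
        by (simp add: w)
    qed
    show "wedge (z (p ?c)) (z (p (g + (j + 2) mod 5 * m))) \<ge> 0"
    proof -
      have "sin (\<theta> (?c + 2 * m) - \<theta> ?c) \<ge> 0"
        using lt gap[of ?c] by (intro sin_ge_zero) auto
      then show ?thesis
        using wrap[of j 2 g] gj by (simp add: w)
    qed
  qed
qed

section \<open>Points on the unit circle and the assembly of the five-point groups\<close>

text \<open>Supplies the nonzero vectors with distinct arguments that the cyclic ordering requires.
  A point of the circle is an extreme point of the disc, so \<open>\<mu>\<close> cannot be one of
  the \<open>l j\<close>: a set \<open>S\<close> of \<open>Suc n\<close> indices omitting
  \<open>j\<close> would contradict the hull condition.\<close>

lemma points_on_circle_seen_from_hull:
  fixes l :: "nat \<Rightarrow> complex"
  assumes n: "Suc n < N" and l: "\<And>i. i < N \<Longrightarrow> cmod (l i) = 1" "inj_on l {..<N}"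
    and hull: "\<And>S. S \<subseteq> {..<N} \<Longrightarrow> card S = Suc n \<Longrightarrow> \<mu> \<in> convex hull (l ` S)"
  shows "\<And>i. i < N \<Longrightarrow> l i \<noteq> \<mu>" "inj_on (\<lambda>i. Arg (l i - \<mu>)) {..<N}"
proof -
  show ne: "l j \<noteq> \<mu>" if j: "j < N" for j
  proof
    assume eq: "l j = \<mu>"
    have "Suc n \<le> card ({..<N} - {j})" using j n by simp
    then obtain S where S: "S \<subseteq> {..<N} - {j}" "card S = Suc n"
      by (rule obtain_subset_with_card_n)
    have "\<mu> \<in> convex hull (l ` S)"
      using S by (intro hull) auto
    then have "0 \<in> convex hull ((\<lambda>x. - \<mu> + x) ` l ` S)"
      unfolding convex_hull_translation by force
    \<comment> \<open>This choice gives the half-plane bounded by the tangent at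
      \<open>\<mu>\<close>: for points of the circle the real part equals half of the squared
      distance to \<open>\<mu>\<close>.\<close>
    from convex_hull_not_open_half_plane[OF this, of "- cnj \<mu>"]
    obtain i where i: "i \<in> S" "Re (- cnj \<mu> * (- \<mu> + l i)) \<le> 0" by auto
    have nm: "cmod (l i) = 1" "cmod \<mu> = 1" "i < N" using l(1) i S j eq by auto
    have "(cmod (l i - \<mu>))\<^sup>2 \<le> 0"
      using i(2) nm(1,2)[THEN arg_cong[where f = "\<lambda>x. x\<^sup>2"]]
      unfolding cmod_power2 by (simp add: power2_eq_square algebra_simps)
    then have "l i = l j" using eq by simp
    then show False
      using l(2) nm(3) j i(1) S(1) by (auto dest: inj_onD)
  qed
  show "inj_on (\<lambda>i. Arg (l i - \<mu>)) {..<N}"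
  proof (rule inj_onI, rule ccontr)
    fix i j assume ij: "i \<in> {..<N}" "j \<in> {..<N}" "Arg (l i - \<mu>) = Arg (l j - \<mu>)" "i \<noteq> j"
    (* A ray from a point of the disc cannot meet the circle at two distances r, s > 0, since
       those would be the roots of a monic quadratic with constant term |mu|^2 - 1 <= 0. *)
    define u where "u = cis (Arg (l i - \<mu>))"
    define r where "r = cmod (l i - \<mu>)"
    define s where "s = cmod (l j - \<mu>)"
    have "l i - \<mu> = r *\<^sub>R u" "l j - \<mu> = s *\<^sub>R u"
      unfolding r_def s_def u_def scaleR_conv_of_real using rcis_cmod_Arg ij(3) rcis_def by metis+
    then have li: "l i = \<mu> + r *\<^sub>R u" and lj: "l j = \<mu> + s *\<^sub>R u"
      by (simp_all only: diff_eq_eq add.commute)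
    have "l i \<noteq> \<mu>" "l j \<noteq> \<mu>" "l i \<noteq> l j"
      using ne ij l(2) by (auto dest: inj_onD)
    then have rs: "r > 0" "s > 0" "r \<noteq> s"
      unfolding li lj by (auto simp: r_def s_def)
    \<comment> \<open>Any one admissible index set suffices to place \<open>\<mu>\<close> in the
      closed unit disc.\<close>
    have "card {..n} = Suc n" by simp
    then have "\<mu> \<in> convex hull (l ` {..n})" using n by (intro hull) auto
    moreover have "l ` {..n} \<subseteq> cball 0 1"
      using l(1) n by auto
    ultimately have "cmod \<mu> \<le> 1"
      using hull_minimal[of "l ` {..n}" "cball 0 1" convex] by auto
    then have mu: "(Re \<mu>)\<^sup>2 + (Im \<mu>)\<^sup>2 \<le> 1"
      by (metis cmod_power2 norm_ge_zero power_le_one)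
    define b where "b = Re \<mu> * Re u + Im \<mu> * Im u"
    have uu: "(Re u)\<^sup>2 + (Im u)\<^sup>2 = 1" by (simp add: u_def)
    have quad: "(Re \<mu>)\<^sup>2 + (Im \<mu>)\<^sup>2 + 2 * t * b + t\<^sup>2 = 1" if "cmod (\<mu> + t *\<^sub>R u) = 1" for t
    proof -
      have "(cmod (\<mu> + t *\<^sub>R u))\<^sup>2 = 1" using that by simp
      then have "(Re \<mu>)\<^sup>2 + (Im \<mu>)\<^sup>2 + 2 * t * b + t\<^sup>2 * ((Re u)\<^sup>2 + (Im u)\<^sup>2) = 1"
        unfolding cmod_power2 b_def by (simp add: power2_eq_square algebra_simps)
      then show ?thesis using uu by simp
    qed
    have 1: "(Re \<mu>)\<^sup>2 + (Im \<mu>)\<^sup>2 + 2 * r * b + r\<^sup>2 = 1"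
      "(Re \<mu>)\<^sup>2 + (Im \<mu>)\<^sup>2 + 2 * s * b + s\<^sup>2 = 1"
      using quad[of r] quad[of s] l(1)[of i] l(1)[of j] ij(1,2) unfolding li lj by simp_all
    then have "(r - s) * (2 * b + r + s) = 0"
      by (simp add: power2_eq_square algebra_simps)
    then have "2 * b = - (r + s)" using rs by simp
    then have "2 * r * b = - (r + s) * r" by simp
    then have "(Re \<mu>)\<^sup>2 + (Im \<mu>)\<^sup>2 = 1 + r * s"
      using 1(1) by (simp add: power2_eq_square algebra_simps)
    then show False using mu rs mult_pos_pos[of r s] by linarith
  qed
qed

text \<open>Each of the \<open>m\<close> groups contributes two orthonormal vectors, and different
  groups have disjoint supports, so all mixed sums vanish. Orthonormality turns the equations for
  \<open>l i - \<mu>\<close> into those for \<open>l i\<close>.\<close>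

lemma real_isotropic_frame:
  fixes l :: "nat \<Rightarrow> complex" and m :: nat
  assumes m: "m \<ge> 1" and l: "\<And>i. i < 5 * m \<Longrightarrow> cmod (l i) = 1" "inj_on l {..<5 * m}"
    and hull: "\<And>S. S \<subseteq> {..<5 * m} \<Longrightarrow> card S = 3 * m + 1 \<Longrightarrow> \<mu> \<in> convex hull (l ` S)"
  obtains Y :: "nat \<Rightarrow> nat \<Rightarrow> real" where
    "\<And>c d. c < 2 * m \<Longrightarrow> d < 2 * m \<Longrightarrow> (\<Sum>i<5 * m. Y i c * Y i d) = (if c = d then 1 else 0)"
    "\<And>c d. c < 2 * m \<Longrightarrow> d < 2 * m \<Longrightarrow>
      (\<Sum>i<5 * m. (Y i c * Y i d) *\<^sub>R l i) = (if c = d then \<mu> else 0)"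
proof -
  define z where "z i = l i - \<mu>" for i
  have n: "Suc (3 * m) < 5 * m" using m by linarith
  have z: "\<And>i. i < 5 * m \<Longrightarrow> z i \<noteq> 0" "inj_on (\<lambda>i. Arg (z i)) {..<5 * m}"
    using points_on_circle_seen_from_hull[OF n l, of \<mu>] hull by (simp_all add: z_def)
  have "0 \<in> convex hull (z ` S)" if "S \<subseteq> {..<5 * m}" "card S = 3 * m + 1" for S
  proof -
    have "z ` S = (\<lambda>x. - \<mu> + x) ` l ` S" by (force simp: z_def)
    then show ?thesis
      using hull[OF that] unfolding \<open>z ` S = _\<close> convex_hull_translation by force
  qed
  from five_groups[OF m z this] obtain p where p: "bij_betw p {..<5 * m} {..<5 * m}" and
    w: "\<And>g j. g < m \<Longrightarrow> j < 5 \<Longrightarrow> wedge (z (p (g + j * m))) (z (p (g + (j + 1) mod 5 * m))) > 0"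
    "\<And>g j. g < m \<Longrightarrow> j < 5 \<Longrightarrow> wedge (z (p (g + j * m))) (z (p (g + (j + 2) mod 5 * m))) \<ge> 0"
    by blast
  define isotropic where "isotropic g f \<longleftrightarrow> (\<forall>b<2. \<forall>b'<2.
      (\<Sum>t<5. f b t * f b' t) = (if b = b' then 1 else 0) \<and>
      (\<Sum>t<5. (f b t * f b' t) *\<^sub>R z (p (g + t * m))) = 0)" for g and f :: "nat \<Rightarrow> nat \<Rightarrow> real"
  have "\<exists>f. isotropic g f" if g: "g < m" for g
  proof -
    obtain u v :: "nat \<Rightarrow> real" where uv:
      "(\<Sum>t<5. u t * u t) = 1" "(\<Sum>t<5. u t * v t) = 0" "(\<Sum>t<5. v t * v t) = 1"
      "(\<Sum>t<5. (u t * u t) *\<^sub>R z (p (g + t * m))) = 0"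
      "(\<Sum>t<5. (u t * v t) *\<^sub>R z (p (g + t * m))) = 0"
      "(\<Sum>t<5. (v t * v t) *\<^sub>R z (p (g + t * m))) = 0"
      by (rule five_points[of "\<lambda>t. z (p (g + t * m))"]) (use w g in auto)
    have vu: "(\<Sum>t<5. v t * u t) = 0" "(\<Sum>t<5. (v t * u t) *\<^sub>R z (p (g + t * m))) = 0"
      using uv(2,5) by (simp_all only: mult.commute)
    let ?f = "\<lambda>b :: nat. if b = 0 then u else v"
    have "(\<Sum>t<5. ?f b t * ?f b' t) = (if b = b' then 1 else 0) \<and>
        (\<Sum>t<5. (?f b t * ?f b' t) *\<^sub>R z (p (g + t * m))) = 0" if bb: "b < 2" "b' < 2" for b b'
    proof -
      consider "b = 0" "b' = 0" | "b = 0" "b' = 1" | "b = 1" "b' = 0" | "b = 1" "b' = 1"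
        using less_2_cases[OF bb(1)] less_2_cases[OF bb(2)] by auto
      then show ?thesis by cases (simp_all only: uv vu simp_thms if_True if_False zero_neq_one one_neq_zero)
    qed
    then have "isotropic g ?f" unfolding isotropic_def by blast
    then show ?thesis by blast
  qed
  then obtain F where "\<And>g. g < m \<Longrightarrow> isotropic g (F g)" by metis
  then have F: "(\<Sum>t<5. F g b t * F g b' t) = (if b = b' then 1 else 0)"
    "(\<Sum>t<5. (F g b t * F g b' t) *\<^sub>R z (p (g + t * m))) = 0"
    if "g < m" "b < 2" "b' < 2" for g b b'
    using that unfolding isotropic_def by blast+
  define q where "q = the_inv_into {..<5 * m} p"
  \<comment> \<open>Column \<open>c\<close> is vector \<open>c mod 2\<close> of group
    \<open>c div 2\<close>. The position \<open>q i\<close> of point \<open>i\<close> splits into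
    its group, modulo \<open>m\<close>, and its place in the group, the quotient by
    \<open>m\<close>.\<close>
  define Y where "Y i c = (if q i mod m = c div 2 then F (c div 2) (c mod 2) (q i div m) else 0)"
    for i c
  have bij: "bij_betw (\<lambda>(g, j). g + j * m) ({..<m} \<times> {..<5}) {..<5 * m}"
  proof (rule bij_betw_byWitness[where f' = "\<lambda>i. (i mod m, i div m)"])
    have "g + j * m < 5 * m" if "g < m" "j < 5" for g j
    proof -
      have "j * m \<le> 4 * m" using that by (intro mult_right_mono) auto
      then show ?thesis using that by linarith
    qed
    then show "(\<lambda>(g, j). g + j * m) ` ({..<m} \<times> {..<5}) \<subseteq> {..<5 * m}" by auto
  qed (use m in \<open>auto simp: less_mult_imp_div_less\<close>)
  have inrange: "g + j * m < 5 * m" if "g < m" "j < 5" for g j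
    using bij_betwE[OF bij] that by auto
  have reindex: "(\<Sum>i<5 * m. G i) = (\<Sum>g<m. \<Sum>j<5. G (p (g + j * m)))"
    for G :: "nat \<Rightarrow> 'b :: comm_monoid_add"
  proof -
    have "(\<Sum>i<5 * m. G i) = (\<Sum>i<5 * m. G (p i))"
      using sum.reindex_bij_betw[OF p, of G] by simp
    also have "\<dots> = (\<Sum>(g, j)\<in>{..<m} \<times> {..<5}. G (p (g + j * m)))"
      using sum.reindex_bij_betw[OF bij, of "\<lambda>i. G (p i)"] by (simp add: case_prod_unfold)
    finally show ?thesis by (simp add: sum.cartesian_product)
  qed
  have Yp: "Y (p (g + j * m)) c = (if g = c div 2 then F (c div 2) (c mod 2) j else 0)"
    if "g < m" "j < 5" for g j c
  proof -
    have "q (p (g + j * m)) = g + j * m"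
      using p inrange[OF that] by (simp add: q_def bij_betw_def the_inv_into_f_f)
    then show ?thesis unfolding Y_def \<open>q _ = _\<close> using that by simp
  qed
  have cd: "c = d \<longleftrightarrow> c div 2 = d div 2 \<and> c mod 2 = d mod 2" for c d :: nat
    by (metis div_mult_mod_eq)
  have G: "(\<Sum>i<5 * m. Y i c * Y i d) = (if c = d then 1 else 0)"
    if "c < 2 * m" "d < 2 * m" for c d
  proof -
    have "(\<Sum>i<5 * m. Y i c * Y i d) = (\<Sum>g<m. if g = c div 2 then
        (if c div 2 = d div 2 then \<Sum>j<5. F (c div 2) (c mod 2) j * F (c div 2) (d mod 2) j else 0) else 0)"
      unfolding reindex by (intro sum.cong refl) (auto simp: Yp)
    also have "\<dots> = (if c = d then 1 else 0)"
      using that by (auto simp: F cd[of c d])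
    finally show ?thesis .
  qed
  have Z: "(\<Sum>i<5 * m. (Y i c * Y i d) *\<^sub>R z i) = 0" if "c < 2 * m" "d < 2 * m" for c d
  proof -
    have "(\<Sum>i<5 * m. (Y i c * Y i d) *\<^sub>R z i) = (\<Sum>g<m. if g = c div 2 then
        (if c div 2 = d div 2 then
          \<Sum>j<5. (F (c div 2) (c mod 2) j * F (c div 2) (d mod 2) j) *\<^sub>R z (p (c div 2 + j * m)) else 0) else 0)"
      unfolding reindex by (intro sum.cong refl) (auto simp: Yp)
    also have "\<dots> = 0"
      using that by (auto simp: F)
    finally show ?thesis .
  qed
  have "(\<Sum>i<5 * m. (Y i c * Y i d) *\<^sub>R l i) = (if c = d then \<mu> else 0)"
    if "c < 2 * m" "d < 2 * m" for c d
  proof -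
    have "(\<Sum>i<5 * m. (Y i c * Y i d) *\<^sub>R l i)
        = (\<Sum>i<5 * m. (Y i c * Y i d) *\<^sub>R z i) + (\<Sum>i<5 * m. Y i c * Y i d) *\<^sub>R \<mu>"
      by (simp add: z_def scaleR_right_diff_distrib sum_subtractf scaleR_sum_left)
    then show ?thesis using G[OF that] Z[OF that] by simp
  qed
  with G that show thesis by blast
qed

section \<open>Isometries, projections and eigenvectors\<close>

lemma mat_adjoint_carrier [simp]:
  "A \<in> carrier_mat n k \<Longrightarrow> mat_adjoint A \<in> carrier_mat k n"
  unfolding mat_adjoint_def by auto

lemma mat_adjoint_dim [simp]:
  "dim_row (mat_adjoint A) = dim_col A" "dim_col (mat_adjoint A) = dim_row A"
  unfolding mat_adjoint_def by auto

lemma mat_adjoint_index: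
  fixes A :: "complex mat"
  assumes "A \<in> carrier_mat n k" "i < k" "j < n"
  shows "mat_adjoint A $$ (i, j) = cnj (A $$ (j, i))"
  using assms unfolding mat_adjoint_def
  by (simp add: mat_of_rows_index)

lemma mult_mat_index_sum:
  fixes A B :: "'a :: semiring_0 mat"
  assumes "A \<in> carrier_mat nr n" "B \<in> carrier_mat n nc" "i < nr" "j < nc"
  shows "(A * B) $$ (i, j) = (\<Sum>a<n. A $$ (i, a) * B $$ (a, j))"
  using assms by (simp add: scalar_prod_def atLeast0LessThan)

lemma mat_adjoint_adjoint:
  fixes A :: "complex mat"
  assumes "A \<in> carrier_mat n k"
  shows "mat_adjoint (mat_adjoint A) = A"
proof (rule eq_matI)
  fix i j assume "i < dim_row A" "j < dim_col A"
  then show "mat_adjoint (mat_adjoint A) $$ (i, j) = A $$ (i, j)"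
    using assms by (simp add: mat_adjoint_index[of _ k n] mat_adjoint_index[of _ n k])
qed simp_all

lemma mat_adjoint_mult:
  fixes A B :: "complex mat"
  assumes A: "A \<in> carrier_mat n k" and B: "B \<in> carrier_mat k l"
  shows "mat_adjoint (A * B) = mat_adjoint B * mat_adjoint A"
proof (rule eq_matI)
  have AB: "A * B \<in> carrier_mat n l" using A B by simp
  have R: "mat_adjoint B * mat_adjoint A \<in> carrier_mat l n" by (intro mult_carrier_mat[OF mat_adjoint_carrier[OF B] mat_adjoint_carrier[OF A]])
  fix i j assume "i < dim_row (mat_adjoint B * mat_adjoint A)" "j < dim_col (mat_adjoint B * mat_adjoint A)"
  then have ij: "i < l" "j < n" using R by auto
  show "mat_adjoint (A * B) $$ (i, j) = (mat_adjoint B * mat_adjoint A) $$ (i, j)"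
    unfolding mat_adjoint_index[OF AB ij] mult_mat_index_sum[OF A B ij(2,1)]
      mult_mat_index_sum[OF mat_adjoint_carrier[OF B] mat_adjoint_carrier[OF A] ij]
    using A B ij by (simp add: mat_adjoint_index mult.commute)
qed simp_all

text \<open>The left inverse \<open>mat_adjoint X\<close> makes the columns of \<open>X\<close>
  independent. Since \<open>X *\<^sub>v w\<close> is fixed by \<open>X * mat_adjoint X\<close>, the
  two matrices have the same column space.\<close>

lemma rank_isometry_mult_adjoint:
  fixes X :: "complex mat"
  assumes X: "X \<in> carrier_mat n k" and iso: "mat_adjoint X * X = 1\<^sub>m k"
  shows "vec_space.rank n (X * mat_adjoint X) = k"
proof -
  interpret vec_space "TYPE(complex)" n .
  have X': "mat_adjoint X \<in> carrier_mat k n" using X by simp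
  have cancel: "mat_adjoint X *\<^sub>v (X *\<^sub>v v) = v" if "v \<in> carrier_vec k" for v
    using that X X' iso by (metis assoc_mult_mat_vec one_mult_mat_vec)
  have col: "mat_adjoint X *\<^sub>v col X i = unit_vec k i" if "i < k" for i
    using col_mult2[OF X' X that] iso that by simp
  have "distinct (cols X)"
    unfolding distinct_conv_nth
  proof (intro allI impI)
    fix i j assume ij: "i < length (cols X)" "j < length (cols X)" "i \<noteq> j"
    then have k: "i < k" "j < k" using X by auto
    have "unit_vec k i \<noteq> (unit_vec k j :: complex vec)"
      using k ij(3) unit_vec_eq by blast
    then show "cols X ! i \<noteq> cols X ! j"
      using col[OF k(1)] col[OF k(2)] k X by force
  qed
  moreover have "lin_indpt (set (cols X))"
  proof
    assume "lin_dep (set (cols X))"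
    from lin_depE[OF X this \<open>distinct (cols X)\<close>] obtain v where
      v: "v \<in> carrier_vec k" "v \<noteq> 0\<^sub>v k" "X *\<^sub>v v = 0\<^sub>v n" .
    have "v = mat_adjoint X *\<^sub>v 0\<^sub>v n" using cancel[OF v(1)] v(3) by simp
    also have "\<dots> = 0\<^sub>v k" using X X' by (intro eq_vecI) auto
    finally show False using v(2) by contradiction
  qed
  ultimately have "rank X = k"
    by (rule lin_indpt_full_rank[OF X])
  moreover have "col_space (X * mat_adjoint X) = col_space X"
  proof -
    have P: "X * mat_adjoint X \<in> carrier_mat n n" using X X' by simp
    have "\<exists>v\<in>carrier_vec n. (X * mat_adjoint X) *\<^sub>v v = X *\<^sub>v w" if "w \<in> carrier_vec k" for w
      using that X X' cancel[OF that]
      by (intro bexI[of _ "X *\<^sub>v w"]) (auto simp: assoc_mult_mat_vec[OF X X'])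
    moreover have "\<exists>w\<in>carrier_vec k. X *\<^sub>v w = (X * mat_adjoint X) *\<^sub>v v" if "v \<in> carrier_vec n" for v
      using that assoc_mult_mat_vec[OF X X' that] mult_mat_vec_carrier[OF X' that] by metis
    ultimately show ?thesis
      unfolding col_space_eq[OF X] col_space_eq[OF P] using X P by (auto; metis)
  qed
  ultimately show ?thesis
    unfolding rank_def col_space_def by simp
qed

text \<open>The witness is the projection \<open>X * mat_adjoint X\<close> onto the range of
  \<open>X\<close>; regrouping the products exposes the compression in the middle.\<close>

lemma isometric_compression_in_higher_rank_numerical_range:
  fixes T X :: "complex mat"
  assumes T: "T \<in> carrier_mat n n" and X: "X \<in> carrier_mat n k"
    and iso: "mat_adjoint X * X = 1\<^sub>m k" and comp: "mat_adjoint X * T * X = \<mu> \<cdot>\<^sub>m 1\<^sub>m k"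
  shows "\<mu> \<in> higher_rank_numerical_range k T"
proof -
  let ?A = "mat_adjoint X"
  let ?P = "X * ?A"
  have A: "?A \<in> carrier_mat k n" using X by simp
  have "?P * ?P = X * (?A * X) * ?A"
    using X A by (simp add: assoc_mult_mat[of _ n k _ n _ n] assoc_mult_mat[of _ n k _ k _ n]
        assoc_mult_mat[of _ k n _ k _ n] mult_carrier_mat[of _ k n] mult_carrier_mat[of _ n k])
  then have "orthogonal_projection n ?P"
    unfolding orthogonal_projection_def
    using X A iso mat_adjoint_mult[OF X A] mat_adjoint_adjoint[OF X] by simp
  moreover have "?P * T * ?P = \<mu> \<cdot>\<^sub>m ?P"
  proof -
    have AT: "?A * T \<in> carrier_mat k n" and XA: "X * ?A \<in> carrier_mat n n"
      and ATX: "?A * T * X \<in> carrier_mat k k"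
      by (rule mult_carrier_mat[OF A T] mult_carrier_mat[OF X A]
          mult_carrier_mat[OF mult_carrier_mat[OF A T] X])+
    have "?P * T * ?P = X * (?A * T) * (X * ?A)"
      using assoc_mult_mat[OF X A T] by simp
    also have "\<dots> = X * ((?A * T) * (X * ?A))"
      by (rule assoc_mult_mat[OF X AT XA])
    also have "(?A * T) * (X * ?A) = (?A * T * X) * ?A"
      by (rule assoc_mult_mat[OF AT X A, symmetric])
    also have "\<dots> = \<mu> \<cdot>\<^sub>m ?A"
      unfolding comp by (simp only: mult_smult_assoc_mat[OF one_carrier_mat A] left_mult_one_mat[OF A])
    also have "X * (\<mu> \<cdot>\<^sub>m ?A) = \<mu> \<cdot>\<^sub>m ?P"
      by (rule mult_smult_distrib[OF X A])
    finally show ?thesis .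
  qed
  ultimately show ?thesis
    unfolding higher_rank_numerical_range_def
    using rank_isometry_mult_adjoint[OF X iso] T by auto
qed

text \<open>A dimension count: on the range of \<open>P\<close>, of dimension \<open>Suc k\<close>,
  the matrix \<open>C\<close> imposes only \<open>k\<close> conditions. Its zero last row pads
  \<open>C * B\<close> to a square matrix, so that a determinant yields the kernel vector.\<close>

lemma projection_range_meets_kernel:
  fixes P C :: "complex mat"
  assumes P: "P \<in> carrier_mat n n" "P * P = P" and rank: "vec_space.rank n P = Suc k"
    and C: "C \<in> carrier_mat (Suc k) n" "\<And>a. a < n \<Longrightarrow> C $$ (k, a) = 0"
  obtains x where "x \<in> carrier_vec n" "x \<noteq> 0\<^sub>v n" "P *\<^sub>v x = x" "C *\<^sub>v x = 0\<^sub>v (Suc k)"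
proof -
  interpret vec_space "TYPE(complex)" n .
  \<comment> \<open>A maximal independent set of columns is a basis of the range of
    \<open>P\<close>.\<close>
  obtain S where S: "finite S" "maximal S (\<lambda>T. T \<subseteq> set (cols P) \<and> lin_indpt T)"
    using maximal_exists_superset[of "set (cols P)" "\<lambda>T. T \<subseteq> set (cols P) \<and> lin_indpt T" "{}"]
      finite_lin_indpt2[of "{}"] by auto
  have card: "card S = Suc k" and S': "S \<subseteq> set (cols P)" "lin_indpt S"
    using rank_card_indpt[OF P(1) S(2)] rank S(2) by (simp_all add: maximal_def)
  obtain bs where bs: "set bs = S" "distinct bs"
    using finite_distinct_list[OF S(1)] by blast
  then have len: "length bs = Suc k" using card distinct_card by fastforce
  have bsc: "set bs \<subseteq> carrier_vec n" using bs S' P(1) cols_dim by fastforce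
  define B where "B = mat_of_cols n bs"
  have B: "B \<in> carrier_mat n (Suc k)" and cB: "cols B = bs"
    using bsc by (auto simp: B_def len)
  \<comment> \<open>The columns of \<open>B\<close> are columns of \<open>P\<close>, and idempotence
    says that \<open>P\<close> fixes those.\<close>
  have PB: "P * B = B"
  proof (rule mat_col_eqI)
    fix j assume "j < dim_col B"
    then have j: "j < Suc k" using B by simp
    have "col B j \<in> set (cols P)"
      using j len bs S' cB B by (metis cols_length cols_nth carrier_matD(2) nth_mem subsetD)
    then obtain i where i: "i < n" "col B j = col P i"
      using P(1) by (auto simp: cols_def)
    have "col (P * B) j = P *\<^sub>v col P i"
      using col_mult2[OF P(1) B j] i by simp
    also have "\<dots> = col (P * P) i"
      using col_mult2[OF P(1) P(1) i(1)] by simp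
    finally show "col (P * B) j = col B j" using P(2) i by simp
  qed (use P B in auto)
  have CB: "C * B \<in> carrier_mat (Suc k) (Suc k)" using C B by simp
  have "det (C * B) = (\<Sum>j<Suc k. (C * B) $$ (k, j) * cofactor (C * B) k j)"
    by (rule laplace_expansion_row[OF CB]) simp
  also have "\<dots> = 0"
    by (intro sum.neutral) (auto simp: mult_mat_index_sum[OF C(1) B] C(2))
  finally obtain v where v: "v \<in> carrier_vec (Suc k)" "v \<noteq> 0\<^sub>v (Suc k)" "(C * B) *\<^sub>v v = 0\<^sub>v (Suc k)"
    using det_0_iff_vec_prod_zero_field[OF CB] by blast
  show thesis
  proof (rule that[of "B *\<^sub>v v"])
    show "B *\<^sub>v v \<noteq> 0\<^sub>v n"
      using lin_depI[OF B v(1,2)] cB bs S' by auto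
    show "P *\<^sub>v (B *\<^sub>v v) = B *\<^sub>v v"
      using assoc_mult_mat_vec[OF P(1) B v(1)] PB by simp
    show "C *\<^sub>v (B *\<^sub>v v) = 0\<^sub>v (Suc k)"
      using assoc_mult_mat_vec[OF C(1) B v(1)] v(3) by simp
  qed (use B v in auto)
qed

section \<open>Diagonalization of a unitary operator with distinct eigenvalues\<close>

lemma spectrum_eq_eigvals:
  assumes "T \<in> carrier_mat n n"
  shows "spectrum T = set (eigvals T)"
  unfolding spectrum_root_char_poly[OF assms] char_poly_eigvals(1)[OF assms]
  by (auto simp: poly_prod_list prod_list_zero_iff)

text \<open>Unitarity gives \<open>G $$ (i, j) = cnj (l i) * l j * G $$ (i, j)\<close> for the Gram
  matrix \<open>G\<close> of eigenvectors. The positive diagonal forces unit modulus, and then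
  distinct eigenvalues force orthogonality.\<close>

lemma unitary_diagonalization:
  assumes U: "unitary_mat n U" and card: "card (spectrum U) = n"
  defines "l \<equiv> \<lambda>i. eigvals U ! i"
  obtains V where "V \<in> carrier_mat n n" "mat_adjoint V * V = 1\<^sub>m n" "V * mat_adjoint V = 1\<^sub>m n"
    "U * V = V * mat_diag n l" "\<And>i. i < n \<Longrightarrow> cmod (l i) = 1" "inj_on l {..<n}"
proof -
  have Uc: "U \<in> carrier_mat n n" and UU: "mat_adjoint U * U = 1\<^sub>m n"
    using U by (auto simp: unitary_mat_def)
  have len: "length (eigvals U) = n" and spec: "spectrum U = set (eigvals U)"
    using char_poly_eigvals(2)[OF Uc] spectrum_eq_eigvals[OF Uc] by auto
  have dist: "distinct (eigvals U)"
    using card len spec card_distinct by metis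
  then have inj: "inj_on l {..<n}"
    unfolding l_def by (auto simp: inj_on_def nth_eq_iff_index_eq len)
  have "\<exists>v. eigenvector U v (l i)" if "i < n" for i
    using that spec len nth_mem[of i "eigvals U"] by (auto simp: spectrum_def l_def eigenvalue_def)
  then obtain v where v: "\<And>i. i < n \<Longrightarrow> eigenvector U (v i) (l i)" by metis
  have vc: "v i \<in> carrier_vec n" "v i \<noteq> 0\<^sub>v n" "U *\<^sub>v v i = l i \<cdot>\<^sub>v v i" if "i < n" for i
    using v[OF that] Uc by (auto simp: eigenvector_def)
  let ?D = "mat_diag n l"
  define W where "W = Matrix.mat n n (\<lambda>(a, i). v i $ a)"
  have W: "W \<in> carrier_mat n n" by (simp add: W_def)
  have colW: "col W i = v i" if "i < n" for i
    using vc(1)[OF that] that by (auto simp: W_def)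
  have UW: "U * W = W * ?D"
  proof (rule mat_col_eqI)
    fix j assume "j < dim_col (W * ?D)"
    then have j: "j < n" by (simp add: mat_diag_def)
    have "col (U * W) j = l j \<cdot>\<^sub>v v j"
      using col_mult2[OF Uc W j] colW[OF j] vc(3)[OF j] by simp
    also have "\<dots> = col (W * ?D) j"
      unfolding mat_diag_mult_right[OF W] using j vc(1)[OF j] by (auto simp: W_def mult.commute)
    finally show "col (U * W) j = col (W * ?D) j" .
  qed (use Uc W in \<open>auto simp: mat_diag_def\<close>)
  define G where "G = mat_adjoint W * W"
  have A: "mat_adjoint W \<in> carrier_mat n n" "mat_adjoint U \<in> carrier_mat n n"
    "mat_adjoint ?D \<in> carrier_mat n n" "?D \<in> carrier_mat n n"
    using W Uc by simp_all
  have G: "G \<in> carrier_mat n n" unfolding G_def by (rule mult_carrier_mat[OF A(1) W])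
  have Gij: "G $$ (i, j) = (\<Sum>a<n. cnj (W $$ (a, i)) * W $$ (a, j))" if "i < n" "j < n" for i j
    unfolding G_def mult_mat_index_sum[OF A(1) W that]
    using that by (intro sum.cong refl) (simp add: mat_adjoint_index[OF W])
  \<comment> \<open>The Gram matrix of the columns is computed twice: \<open>U\<close> cancels
    against its adjoint, while \<open>U * W = W * ?D\<close> brings in the eigenvalues.\<close>
  have "mat_adjoint (U * W) * (U * W) = mat_adjoint W * (mat_adjoint U * (U * W))"
    using assoc_mult_mat[OF A(1,2) mult_carrier_mat[OF Uc W]] mat_adjoint_mult[OF Uc W] by simp
  also have "mat_adjoint U * (U * W) = W"
    using assoc_mult_mat[OF A(2) Uc W] UU W by simp
  finally have "mat_adjoint (W * ?D) * (W * ?D) = G"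
    by (simp only: UW G_def)
  moreover have "(mat_adjoint (W * ?D) * (W * ?D)) $$ (i, j) = cnj (l i) * l j * G $$ (i, j)"
    if ij: "i < n" "j < n" for i j
  proof -
    have WD: "W * ?D \<in> carrier_mat n n" using W A(4) by (rule mult_carrier_mat)
    have e: "(W * ?D) $$ (a, b) = W $$ (a, b) * l b" if "a < n" "b < n" for a b
      unfolding mat_diag_mult_right[OF W] using that by simp
    have "(mat_adjoint (W * ?D) * (W * ?D)) $$ (i, j)
        = (\<Sum>a<n. cnj ((W * ?D) $$ (a, i)) * (W * ?D) $$ (a, j))"
      unfolding mult_mat_index_sum[OF mat_adjoint_carrier[OF WD] WD ij]
      using ij by (intro sum.cong refl) (simp add: mat_adjoint_index[OF WD])
    also have "\<dots> = (\<Sum>a<n. cnj (l i) * l j * (cnj (W $$ (a, i)) * W $$ (a, j)))"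
      using ij by (intro sum.cong refl) (simp add: e del: index_mult_mat)
    finally show ?thesis
      by (simp add: Gij[OF ij] sum_distrib_left)
  qed
  ultimately have GG: "G $$ (i, j) = cnj (l i) * l j * G $$ (i, j)" if "i < n" "j < n" for i j
    using that by simp
  define g where "g i = (\<Sum>a<n. (cmod (W $$ (a, i)))\<^sup>2)" for i
  have Gii: "G $$ (i, i) = of_real (g i)" if "i < n" for i
    unfolding Gij[OF that that] g_def of_real_sum
    by (intro sum.cong refl) (simp only: complex_norm_square mult.commute)
  have g: "g i > 0" if i: "i < n" for i
  proof -
    obtain a where "a < n" "v i $ a \<noteq> 0"
      using vc(1,2)[OF i] by (metis carrier_vecD eq_vecI index_zero_vec)
    then show ?thesis
      unfolding g_def using i by (intro sum_pos2[of _ a]) (auto simp: W_def)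
  qed
  have unit: "cnj (l i) * l i = 1" if "i < n" for i
    using GG[OF that that] g[OF that] by (simp add: Gii[OF that])
  have norm: "cmod (l i) = 1" if "i < n" for i
  proof -
    have "complex_of_real ((cmod (l i))\<^sup>2) = 1"
      using unit[OF that] by (simp only: complex_norm_square mult.commute)
    then have "(cmod (l i))\<^sup>2 = 1"
      by (simp only: of_real_eq_1_iff)
    then show ?thesis
      using norm_ge_zero[of "l i"] by (auto simp: power2_eq_1_iff simp del: norm_ge_zero)
  qed
  have Gdiag: "G $$ (i, j) = 0" if "i < n" "j < n" "i \<noteq> j" for i j
  proof (rule ccontr)
    assume "G $$ (i, j) \<noteq> 0"
    then have "cnj (l i) * l j = 1" using GG[OF that(1,2)] by simp
    then have "l i * (cnj (l i) * l j) = l i" by simp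
    then have "l j = l i" using unit[OF that(1)] by (metis mult.assoc mult.commute mult_1)
    then show False using inj that by (auto dest: inj_onD)
  qed
  \<comment> \<open>\<open>g i\<close> is the squared length of the \<open>i\<close>-th eigenvector,
    so \<open>c\<close> normalizes the columns.\<close>
  define c :: "nat \<Rightarrow> complex" where "c i = of_real (1 / sqrt (g i))" for i
  define V where "V = W * mat_diag n c"
  have V: "V \<in> carrier_mat n n" unfolding V_def using W by (rule mult_carrier_mat) simp
  have Vij: "V $$ (a, i) = W $$ (a, i) * c i" if "a < n" "i < n" for a i
    unfolding V_def mat_diag_mult_right[OF W] using that by simp
  have VV: "mat_adjoint V * V = 1\<^sub>m n"
  proof (rule eq_matI)
    fix i j assume "i < dim_row (1\<^sub>m n :: complex mat)" "j < dim_col (1\<^sub>m n :: complex mat)"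
    then have ij: "i < n" "j < n" by auto
    have "(mat_adjoint V * V) $$ (i, j) = (\<Sum>a<n. c i * c j * (cnj (W $$ (a, i)) * W $$ (a, j)))"
      unfolding mult_mat_index_sum[OF mat_adjoint_carrier[OF V] V ij]
      using ij by (intro sum.cong refl) (simp add: mat_adjoint_index[OF V] Vij c_def)
    also have "\<dots> = c i * c j * G $$ (i, j)"
      by (simp add: Gij[OF ij] sum_distrib_left)
    also have "\<dots> = (if i = j then 1 else 0)"
    proof (cases "i = j")
      case True
      have "c i * c i * of_real (g i) = of_real ((1 / sqrt (g i)) * (1 / sqrt (g i)) * g i)"
        by (simp only: c_def of_real_mult)
      also have "\<dots> = 1" using g[OF ij(1)] by simp
      finally show ?thesis using True Gii ij by simp
    qed (simp add: Gdiag ij)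
    finally show "(mat_adjoint V * V) $$ (i, j) = 1\<^sub>m n $$ (i, j)" using ij by simp
  qed (use V in auto)
  have "V * mat_adjoint V = 1\<^sub>m n"
    using mat_mult_left_right_inverse[OF mat_adjoint_carrier[OF V] V VV] .
  moreover have "U * V = V * ?D"
  proof -
    let ?C = "mat_diag n c"
    have "U * V = (W * ?D) * ?C"
      unfolding V_def using assoc_mult_mat[OF Uc W, of ?C n] UW by simp
    also have "\<dots> = W * (?D * ?C)" by (rule assoc_mult_mat[OF W A(4) mat_diag_dim])
    also have "?D * ?C = ?C * ?D" by (simp add: mult.commute)
    also have "W * (?C * ?D) = V * ?D"
      unfolding V_def by (rule assoc_mult_mat[OF W mat_diag_dim A(4), symmetric])
    finally show ?thesis .
  qed
  ultimately show thesis
    using that V VV norm inj by blast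
qed

lemma diagonal_form_index:
  fixes Y Z :: "complex mat"
  assumes Y: "Y \<in> carrier_mat n k" and Z: "Z \<in> carrier_mat n k'" and ij: "i < k" "j < k'"
  shows "(mat_adjoint Y * mat_diag n l * Z) $$ (i, j) = (\<Sum>a<n. cnj (Y $$ (a, i)) * l a * Z $$ (a, j))"
proof -
  have A: "mat_adjoint Y * mat_diag n l \<in> carrier_mat k n"
    using mat_adjoint_carrier[OF Y] mat_diag_dim by (rule mult_carrier_mat)
  show ?thesis
    unfolding mult_mat_index_sum[OF A Z ij]
    unfolding mat_diag_mult_right[OF mat_adjoint_carrier[OF Y]]
    using ij mat_adjoint_index[OF Y] by (intro sum.cong refl) simp
qed

lemma adjoint_mult_index:
  fixes Y Z :: "complex mat"
  assumes Y: "Y \<in> carrier_mat n k" and Z: "Z \<in> carrier_mat n k'" and ij: "i < k" "j < k'"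
  shows "(mat_adjoint Y * Z) $$ (i, j) = (\<Sum>a<n. cnj (Y $$ (a, i)) * Z $$ (a, j))"
  unfolding mult_mat_index_sum[OF mat_adjoint_carrier[OF Y] Z ij]
  using ij by (intro sum.cong refl) (simp add: mat_adjoint_index[OF Y])

text \<open>Here \<open>Y\<close> holds the coordinates of the columns of \<open>V * Y\<close> in
  the eigenbasis; in these coordinates \<open>U\<close> acts diagonally.\<close>

lemma unitary_conjugate_form:
  fixes U V X :: "complex mat"
  assumes V: "V \<in> carrier_mat n n" "mat_adjoint V * V = 1\<^sub>m n" and U: "U \<in> carrier_mat n n"
    and UV: "U * V = V * mat_diag n l" and Y: "Y \<in> carrier_mat n k"
  shows "mat_adjoint (V * Y) * (V * Y) = mat_adjoint Y * Y"
    "mat_adjoint (V * Y) * U * (V * Y) = mat_adjoint Y * mat_diag n l * Y"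
proof -
  let ?D = "mat_diag n l"
  have c: "mat_adjoint V \<in> carrier_mat n n" "mat_adjoint Y \<in> carrier_mat k n" "V * Y \<in> carrier_mat n k"
    "?D * Y \<in> carrier_mat n k" "?D \<in> carrier_mat n n" "mat_adjoint Y * mat_adjoint V \<in> carrier_mat k n"
    using mat_adjoint_carrier[OF V(1)] mat_adjoint_carrier[OF Y] mult_carrier_mat[OF V(1) Y]
      mult_carrier_mat[OF mat_diag_dim Y] mult_carrier_mat[OF mat_adjoint_carrier[OF Y] mat_adjoint_carrier[OF V(1)]]
    by simp_all
  have cancel: "mat_adjoint V * (V * Z) = Z" if "Z \<in> carrier_mat n k" for Z
    using assoc_mult_mat[OF c(1) V(1) that] V(2) that by simp
  have YV: "mat_adjoint (V * Y) * (V * Z) = mat_adjoint Y * Z" if "Z \<in> carrier_mat n k" for Z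
    using assoc_mult_mat[OF c(2,1) mult_carrier_mat[OF V(1) that]] cancel[OF that]
      mat_adjoint_mult[OF V(1) Y] by simp
  show "mat_adjoint (V * Y) * (V * Y) = mat_adjoint Y * Y"
    by (rule YV[OF Y])
  have "U * (V * Y) = V * (?D * Y)"
    using assoc_mult_mat[OF U V(1) Y] assoc_mult_mat[OF V(1) c(5) Y] UV by simp
  then show "mat_adjoint (V * Y) * U * (V * Y) = mat_adjoint Y * ?D * Y"
    using assoc_mult_mat[OF mat_adjoint_carrier[OF c(3)] U c(3)] YV[OF c(4)]
      assoc_mult_mat[OF c(2,5) Y] by simp
qed

section \<open>The two inclusions\<close>

text \<open>Only \<open>k - 1\<close> eigenvectors lie outside \<open>S\<close>, so the range of
  \<open>P\<close> contains a nonzero \<open>x\<close> orthogonal to them. The squared moduli of its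
  eigencoordinates, normalized, are the weights of a convex combination over \<open>S\<close> equal
  to \<open>\<mu>\<close>.\<close>

lemma higher_rank_numerical_range_subset_Omega:
  assumes U: "unitary_mat n U" and card: "card (spectrum U) = n" and k: "1 \<le> k" "k \<le> n"
  shows "higher_rank_numerical_range k U \<subseteq> Omega k U"
proof
  fix \<mu> assume "\<mu> \<in> higher_rank_numerical_range k U"
  have Uc: "U \<in> carrier_mat n n" using U by (simp add: unitary_mat_def)
  define l where "l i = eigvals U ! i" for i
  obtain V where V: "V \<in> carrier_mat n n" "mat_adjoint V * V = 1\<^sub>m n" "V * mat_adjoint V = 1\<^sub>m n"
    and UV: "U * V = V * mat_diag n l"
    using unitary_diagonalization[OF U card] unfolding l_def by metis
  have V': "mat_adjoint V \<in> carrier_mat n n" using V(1) by simp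
  obtain P where P: "P \<in> carrier_mat n n" "P * P = P" "mat_adjoint P = P"
    "vec_space.rank n P = k" "P * U * P = \<mu> \<cdot>\<^sub>m P"
    using \<open>\<mu> \<in> _\<close> Uc by (auto simp: higher_rank_numerical_range_def orthogonal_projection_def)
  have len: "length (eigvals U) = n" by (rule char_poly_eigvals(2)[OF Uc])
  show "\<mu> \<in> Omega k U"
    unfolding Omega_def Omega_list_def len
  proof (rule INT_I)
    fix S assume "S \<in> {S. S \<subseteq> {..<n} \<and> card S = n - k + 1}"
    then have S: "S \<subseteq> {..<n}" "card S = n - k + 1" by auto
    have "card ({..<n} - S) = k - 1"
      using S k by (simp add: card_Diff_subset finite_subset)
    then obtain js where js: "set js = {..<n} - S" "length js = k - 1"
      using finite_distinct_list[of "{..<n} - S"] distinct_card by (metis finite_Diff finite_lessThan)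
    \<comment> \<open>Row \<open>r\<close> takes the coordinate along eigenvector
      \<open>js ! r\<close>; the extra row \<open>k - 1\<close> is the zero padding that
      \<open>projection_range_meets_kernel\<close> expects.\<close>
    define C where "C = Matrix.mat k n (\<lambda>(r, a). if r < k - 1 then mat_adjoint V $$ (js ! r, a) else 0)"
    have C: "C \<in> carrier_mat (Suc (k - 1)) n" and C0: "\<And>a. a < n \<Longrightarrow> C $$ (k - 1, a) = 0"
      using k by (auto simp: C_def)
    have "vec_space.rank n P = Suc (k - 1)" using P(4) k by simp
    from projection_range_meets_kernel[OF P(1,2) this C C0] obtain x where
      x: "x \<in> carrier_vec n" "x \<noteq> 0\<^sub>v n" "P *\<^sub>v x = x" "C *\<^sub>v x = 0\<^sub>v (Suc (k - 1))" .
    define X where "X = Matrix.mat n 1 (\<lambda>(i, _). x $ i)"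
    have X: "X \<in> carrier_mat n 1" by (simp add: X_def)
    have colX: "col X 0 = x" using x(1) by (auto simp: X_def)
    have MX: "(M * X) $$ (i, 0) = (M *\<^sub>v x) $ i" if "M \<in> carrier_mat q n" "i < q" for M q i
      using that X colX by simp
    have PX: "P * X = X"
    proof (rule eq_matI)
      fix i j assume "i < dim_row X" "j < dim_col X"
      then have ij: "i < n" "j = 0" using X by auto
      show "(P * X) $$ (i, j) = X $$ (i, j)"
        unfolding ij(2) MX[OF P(1) ij(1)] x(3) using ij by (simp add: X_def)
    qed (use P X in auto)
    define Y where "Y = mat_adjoint V * X"
    have Y: "Y \<in> carrier_mat n 1" unfolding Y_def using V' X by (rule mult_carrier_mat)
    have VY: "V * Y = X"
      unfolding Y_def using assoc_mult_mat[OF V(1) V' X] V(3) X by simp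
    have Y0: "Y $$ (i, 0) = 0" if "i < n" "i \<notin> S" for i
    proof -
      have "i \<in> set js" using js that by auto
      then obtain r where r: "r < k - 1" "js ! r = i" using js(2) by (auto simp: in_set_conv_nth)
      have "row C r = row (mat_adjoint V) i"
        using r that V by (auto simp: C_def)
      then have "(mat_adjoint V *\<^sub>v x) $ i = (C *\<^sub>v x) $ r"
        using r that V V' C by simp
      then show ?thesis
        unfolding Y_def MX[OF V' that(1)] x(4) using r by simp
    qed
    have form: "(\<Sum>a<n. cnj (Y $$ (a, 0)) * l a * Y $$ (a, 0))
        = \<mu> * (\<Sum>a<n. cnj (Y $$ (a, 0)) * Y $$ (a, 0))"
    proof -
      have X': "mat_adjoint X \<in> carrier_mat 1 n" using X by simp
      have X'P: "mat_adjoint X * P = mat_adjoint X"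
        using mat_adjoint_mult[OF P(1) X] PX P(3) by simp
      have UP: "U * P \<in> carrier_mat n n" and PU: "P * U \<in> carrier_mat n n"
        using mult_carrier_mat[OF Uc P(1)] mult_carrier_mat[OF P(1) Uc] by auto
      \<comment> \<open>Since \<open>P\<close> fixes \<open>X\<close>, it can be inserted on both
        sides of \<open>U\<close>, which turns the form into \<open>\<mu>\<close> times the squared
        norm.\<close>
      have "mat_adjoint X * U * X = (mat_adjoint X * P) * U * (P * X)"
        by (simp only: X'P PX)
      also have "\<dots> = mat_adjoint X * (P * U) * (P * X)"
        by (simp only: assoc_mult_mat[OF X' P(1) Uc])
      also have "\<dots> = (mat_adjoint X * (P * U) * P) * X"
        by (rule assoc_mult_mat[OF mult_carrier_mat[OF X' PU] P(1) X, symmetric])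
      also have "mat_adjoint X * (P * U) * P = mat_adjoint X * (\<mu> \<cdot>\<^sub>m P)"
        by (simp only: assoc_mult_mat[OF X' PU P(1)] P(5))
      also have "\<dots> = \<mu> \<cdot>\<^sub>m mat_adjoint X"
        by (simp only: mult_smult_distrib[OF X' P(1)] X'P)
      also have "\<dots> * X = \<mu> \<cdot>\<^sub>m (mat_adjoint X * X)"
        by (rule mult_smult_assoc_mat[OF X' X])
      finally have "mat_adjoint Y * mat_diag n l * Y = \<mu> \<cdot>\<^sub>m (mat_adjoint Y * Y)"
        using unitary_conjugate_form[OF V(1,2) Uc UV Y] VY by simp
      then have "(mat_adjoint Y * mat_diag n l * Y) $$ (0, 0) = \<mu> * (mat_adjoint Y * Y) $$ (0, 0)"
        using Y by simp
      then show ?thesis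
        by (simp only: diagonal_form_index[OF Y Y] adjoint_mult_index[OF Y Y] less_one)
    qed
    define w where "w a = (cmod (Y $$ (a, 0)))\<^sup>2" for a
    have ww: "cnj (Y $$ (a, 0)) * Y $$ (a, 0) = of_real (w a)" for a
      by (simp only: w_def complex_norm_square mult.commute)
    have w0: "w a = 0" if "a < n" "a \<notin> S" for a
      using Y0[OF that] by (simp add: w_def)
    have restrict: "(\<Sum>a<n. h a) = (\<Sum>a\<in>S. h a)" if "\<And>a. a < n \<Longrightarrow> a \<notin> S \<Longrightarrow> h a = 0"
      for h :: "nat \<Rightarrow> complex"
      using S(1) that by (intro sum.mono_neutral_right) auto
    have "(\<Sum>a<n. cnj (Y $$ (a, 0)) * l a * Y $$ (a, 0)) = (\<Sum>a<n. w a *\<^sub>R l a)"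
      by (intro sum.cong refl) (simp add: scaleR_conv_of_real flip: ww)
    then have eq: "(\<Sum>a\<in>S. w a *\<^sub>R l a) = \<mu> * of_real (\<Sum>a\<in>S. w a)"
      using form restrict[of "\<lambda>a. w a *\<^sub>R l a"] restrict[of "\<lambda>a. of_real (w a)"] w0
      by (simp add: ww)
    \<comment> \<open>The total weight is the squared norm of the coordinate vector; were it 0, then
      \<open>x\<close> itself would be 0.\<close>
    have "(\<Sum>a\<in>S. w a) \<noteq> 0"
    proof
      assume "(\<Sum>a\<in>S. w a) = 0"
      moreover have "finite S" using S(1) finite_subset by blast
      ultimately have "w a = 0" if "a \<in> S" for a
        using that by (simp add: sum_nonneg_eq_0_iff w_def)
      with w0 have "Y $$ (a, 0) = 0" if "a < n" for a
        using that by (cases "a \<in> S") (auto simp: w_def)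
      then have "Y = 0\<^sub>m n 1" using Y by (intro eq_matI) auto
      then have "X = 0\<^sub>m n 1" using VY V(1) by simp
      then have "x = 0\<^sub>v n" using colX x(1) by auto
      then show False using x(2) by contradiction
    qed
    then have pos: "(\<Sum>a\<in>S. w a) > 0"
      using sum_nonneg[of S w] by (simp add: w_def order_less_le)
    have "\<mu> = (\<Sum>a\<in>S. (w a / (\<Sum>a\<in>S. w a)) *\<^sub>R l a)"
    proof -
      have "(\<Sum>a\<in>S. (w a / (\<Sum>a\<in>S. w a)) *\<^sub>R l a) = (1 / (\<Sum>a\<in>S. w a)) *\<^sub>R (\<Sum>a\<in>S. w a *\<^sub>R l a)"
        by (simp add: scaleR_sum_right)
      also have "\<dots> = \<mu>" unfolding eq using pos by (simp add: scaleR_conv_of_real flip: of_real_sum)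
      finally show ?thesis by simp
    qed
    also have "\<dots> \<in> convex hull (l ` S)"
    proof (rule convex_sum)
      show "finite S" using S(1) finite_subset by blast
      show "(\<Sum>a\<in>S. w a / (\<Sum>a\<in>S. w a)) = 1" using pos by (simp flip: sum_divide_distrib)
      show "w a / (\<Sum>a\<in>S. w a) \<ge> 0" for a using pos by (simp add: w_def)
    qed (auto intro: hull_inc)
    finally show "\<mu> \<in> convex hull ((!) (eigvals U) ` S)"
      by (simp add: l_def[abs_def])
  qed
qed

text \<open>The required isometry is \<open>V * Z\<close>, where the real frame supplies the
  eigencoordinates \<open>Z\<close>. The index sets in \<open>Omega\<close> have
  \<open>5 * m - 2 * m + 1 = 3 * m + 1\<close> elements, as the frame construction needs.\<close>

lemma Omega_subset_higher_rank_numerical_range_5m: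
  assumes m: "m \<ge> 1" and U: "unitary_mat (5 * m) U" and card: "card (spectrum U) = 5 * m"
  shows "Omega (2 * m) U \<subseteq> higher_rank_numerical_range (2 * m) U"
proof
  fix \<mu> assume mu: "\<mu> \<in> Omega (2 * m) U"
  have Uc: "U \<in> carrier_mat (5 * m) (5 * m)" using U by (simp add: unitary_mat_def)
  define l where "l i = eigvals U ! i" for i
  obtain V where V: "V \<in> carrier_mat (5 * m) (5 * m)" "mat_adjoint V * V = 1\<^sub>m (5 * m)"
    and UV: "U * V = V * mat_diag (5 * m) l"
    and l: "\<And>i. i < 5 * m \<Longrightarrow> cmod (l i) = 1" "inj_on l {..<5 * m}"
    using unitary_diagonalization[OF U card] unfolding l_def by metis
  have "\<mu> \<in> convex hull (l ` S)" if "S \<subseteq> {..<5 * m}" "card S = 3 * m + 1" for S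
    using mu that char_poly_eigvals(2)[OF Uc]
    by (simp add: Omega_def Omega_list_def l_def[abs_def])
  from real_isotropic_frame[OF m l this] obtain Y :: "nat \<Rightarrow> nat \<Rightarrow> real" where
    Y: "\<And>c d. c < 2 * m \<Longrightarrow> d < 2 * m \<Longrightarrow> (\<Sum>i<5 * m. Y i c * Y i d) = (if c = d then 1 else 0)"
    "\<And>c d. c < 2 * m \<Longrightarrow> d < 2 * m \<Longrightarrow>
      (\<Sum>i<5 * m. (Y i c * Y i d) *\<^sub>R l i) = (if c = d then \<mu> else 0)"
    by blast
  define Z where "Z = Matrix.mat (5 * m) (2 * m) (\<lambda>(i, c). complex_of_real (Y i c))"
  have Z: "Z \<in> carrier_mat (5 * m) (2 * m)" by (simp add: Z_def)
  have "mat_adjoint Z * Z = 1\<^sub>m (2 * m)"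
  proof (rule eq_matI)
    fix c d assume "c < dim_row (1\<^sub>m (2 * m) :: complex mat)" "d < dim_col (1\<^sub>m (2 * m) :: complex mat)"
    then have cd: "c < 2 * m" "d < 2 * m" by auto
    have "(mat_adjoint Z * Z) $$ (c, d) = of_real (\<Sum>i<5 * m. Y i c * Y i d)"
      unfolding adjoint_mult_index[OF Z Z cd] of_real_sum
      using cd by (intro sum.cong refl) (simp add: Z_def)
    then show "(mat_adjoint Z * Z) $$ (c, d) = 1\<^sub>m (2 * m) $$ (c, d)"
      using Y(1)[OF cd] cd by simp
  qed (use Z in auto)
  moreover have "mat_adjoint Z * mat_diag (5 * m) l * Z = \<mu> \<cdot>\<^sub>m 1\<^sub>m (2 * m)"
  proof (rule eq_matI)
    fix c d assume "c < dim_row (\<mu> \<cdot>\<^sub>m 1\<^sub>m (2 * m) :: complex mat)" "d < dim_col (\<mu> \<cdot>\<^sub>m 1\<^sub>m (2 * m) :: complex mat)"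
    then have cd: "c < 2 * m" "d < 2 * m" by auto
    have "(mat_adjoint Z * mat_diag (5 * m) l * Z) $$ (c, d) = (\<Sum>i<5 * m. (Y i c * Y i d) *\<^sub>R l i)"
      unfolding diagonal_form_index[OF Z Z cd]
      using cd by (intro sum.cong refl) (simp add: Z_def scaleR_conv_of_real)
    then show "(mat_adjoint Z * mat_diag (5 * m) l * Z) $$ (c, d) = (\<mu> \<cdot>\<^sub>m 1\<^sub>m (2 * m)) $$ (c, d)"
      using Y(2)[OF cd] cd by simp
  qed (use Z in auto)
  ultimately show "\<mu> \<in> higher_rank_numerical_range (2 * m) U"
    using isometric_compression_in_higher_rank_numerical_range[OF Uc mult_carrier_mat[OF V(1) Z]]
      unitary_conjugate_form[OF V Uc UV Z] by simp
qed

theorem corollary6p5: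
  fixes m :: nat and U :: "complex mat"
  assumes "m \<ge> 1"
    and "unitary_mat (5 * m) U"
    and "card (spectrum U) = 5 * m"
  shows "higher_rank_numerical_range (2 * m) U = Omega (2 * m) U"
proof (rule subset_antisym)
  show "higher_rank_numerical_range (2 * m) U \<subseteq> Omega (2 * m) U"
    using assms by (intro higher_rank_numerical_range_subset_Omega[where n = "5 * m"]) auto
  show "Omega (2 * m) U \<subseteq> higher_rank_numerical_range (2 * m) U"
    using assms by (rule Omega_subset_higher_rank_numerical_range_5m)
qed

end
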